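(* Let $a\in L^1(I)$ and $\lambda\in\mathbb{R}$. If the operator $L[\lambda]$ is nonresonant both in $X_D$ and in $X_P$, then for all $(t,s)\in I\times I$ $$G_P[\lambda](t,s)=G_D[\lambda](t,s)+\big(r_1[\lambda](t)+r_2[\lambda](t)\big)\,G_P[\lambda](1,s)$$ $$=G_D[\lambda](t,s)+\Big(\frac{\partial}{\partial s}G_D[\lambda](t,1)-\frac{\partial}{\partial s}G_D[\lambda](t,0)\Big)\,G_P[\lambda](1,s).$$
   Context: $I=[0,1]$, $a\in L^1(I)$ is real-valued, $\lambda\in\mathbb{R}$, and $L[\lambda]u(t)=u''(t)+(a(t)+\lambda)u(t)$. $W^{2,1}(I)=\{u\in C(I):u'\in AC(I)\}$, where $AC(I)$ is the set of absolutely continuous functions on $I$. $X_D=\{u\in W^{2,1}(I):u(0)=u(1)=0\}$ (Dirichlet) and $X_P=\{u\in W^{2,1}(I):u(0)=u(1),\,u'(0)=u'(1)\}$ (periodic). $L[\lambda]$ is nonresonant in $X$ if $u=0$ is the only $u\in X$ with $L[\lambda]u=0$ a.e. on $I$. In that case, for every $\sigma\in L^1(I)$ the problem $L[\lambda]u=\sigma$ a.e. on $I$, $u\in X$, has a unique solution, given by $u(t)=\int_0^1G(t,s)\sigma(s)\,ds$, where the continuous function $G:I\times I\to\mathbb{R}$ is the Green's function; it is denoted $G_D[\lambda]$ for $X=X_D$ and $G_P[\lambda]$ for $X=X_P$. $r_1[\lambda]$ is the unique solution of $L[\lambda]u=0$ a.e. on $I$, $u(0)=1$, $u(1)=0$;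 $r_2[\lambda]$ is the unique solution of $L[\lambda]u=0$ a.e. on $I$, $u(0)=0$, $u(1)=1$. Convention: $\frac{\partial}{\partial s}G(t,0)$ and $\frac{\partial}{\partial s}G(t,1)$ are (one-sided) derivatives for $t\in(0,1)$, extended by continuity to $t\in\{0,1\}$. *)

theory Defs
  imports "HOL-Analysis.Analysis"
begin

text \<open>
  A function on \<open>I = [0,1]\<close> is represented by a total function on the reals whose values outside
  \<open>I\<close> are irrelevant: everything below only depends on the values on \<open>I\<close>, and
  equalities between functions are asserted on \<open>I\<close> only.
\<close>

abbreviation I :: "real set" where
  "I \<equiv> {0..1}"

definition L1 :: "(real \<Rightarrow> real) set" where
  "L1 = {f. integrable (lebesgue_on I) f}"

text \<open>
  The library's \<open>absolutely_continuous\<close> is about measures; this is the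
  \<open>\<epsilon>\<close>-\<open>\<delta>\<close> notion for functions.
\<close>

definition AC :: "(real \<Rightarrow> real) set" where
  "AC = {f. \<forall>\<epsilon>>0. \<exists>\<delta>>0. \<forall>(n::nat) x y.
     (\<forall>k<n. 0 \<le> x k \<and> x k \<le> y k \<and> y k \<le> 1) \<and>
     disjoint_family_on (\<lambda>k. {x k<..<y k}) {..<n} \<and>
     (\<Sum>k<n. y k - x k) < \<delta> \<longrightarrow>
     (\<Sum>k<n. \<bar>f (y k) - f (x k)\<bar>) < \<epsilon>}"

text \<open>The derivative is taken within \<open>I\<close>, hence is one-sided at the end points.\<close>

definition D :: "(real \<Rightarrow> real) \<Rightarrow> real \<Rightarrow> real" where
  "D u t = vector_derivative u (at t within I)"

definition W21 :: "(real \<Rightarrow> real) set" where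
  "W21 = {u. continuous_on I u \<and> u differentiable_on I \<and> D u \<in> AC}"

definition X_D :: "(real \<Rightarrow> real) set" where
  "X_D = {u \<in> W21. u 0 = 0 \<and> u 1 = 0}"

definition X_P :: "(real \<Rightarrow> real) set" where
  "X_P = {u \<in> W21. u 0 = u 1 \<and> D u 0 = D u 1}"

text \<open>
  For \<open>u \<in> W21\<close> the second derivative exists almost everywhere on \<open>I\<close>; the
  operator is only used up to null sets.
\<close>

definition L :: "(real \<Rightarrow> real) \<Rightarrow> real \<Rightarrow> (real \<Rightarrow> real) \<Rightarrow> real \<Rightarrow> real" where
  "L a lam u t = D (D u) t + (a t + lam) * u t"

definition nonresonant :: "(real \<Rightarrow> real) set \<Rightarrow> (real \<Rightarrow> real) \<Rightarrow> real \<Rightarrow> bool" where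
  "nonresonant X a lam \<longleftrightarrow>
     (\<forall>u\<in>X. (AE t in lebesgue_on I. L a lam u t = 0) \<longrightarrow> (\<forall>t\<in>I. u t = 0))"

text \<open>
  Uniqueness of the solution of \<open>L a lam u = \<sigma>\<close> in \<open>X\<close> is not part of this predicate: it is
  equivalent to nonresonance in \<open>X\<close>. When \<open>X\<close> is nonresonant, continuity makes the values of \<open>G\<close> on
  \<open>I \<times> I\<close> unique.
\<close>

definition is_green_function ::
    "(real \<Rightarrow> real) set \<Rightarrow> (real \<Rightarrow> real) \<Rightarrow> real \<Rightarrow> (real \<Rightarrow> real \<Rightarrow> real) \<Rightarrow> bool" where
  "is_green_function X a lam G \<longleftrightarrow>
     continuous_on (I \<times> I) (\<lambda>(t, s). G t s) \<and>
     (\<forall>\<sigma>\<in>L1. \<exists>u\<in>X. (\<forall>t\<in>I. u t = (LINT s|lebesgue_on I. G t s * \<sigma> s)) \<and>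
                    (AE t in lebesgue_on I. L a lam u t = \<sigma> t))"

definition is_r1 :: "(real \<Rightarrow> real) \<Rightarrow> real \<Rightarrow> (real \<Rightarrow> real) \<Rightarrow> bool" where
  "is_r1 a lam u \<longleftrightarrow> u \<in> W21 \<and> (AE t in lebesgue_on I. L a lam u t = 0) \<and> u 0 = 1 \<and> u 1 = 0"

definition is_r2 :: "(real \<Rightarrow> real) \<Rightarrow> real \<Rightarrow> (real \<Rightarrow> real) \<Rightarrow> bool" where
  "is_r2 a lam u \<longleftrightarrow> u \<in> W21 \<and> (AE t in lebesgue_on I. L a lam u t = 0) \<and> u 0 = 0 \<and> u 1 = 1"

text \<open>
  On \<open>I\<close>, \<open>d\<close> is the function sending \<open>t\<close> to the partial derivative of \<open>G\<close> in its second
  argument at \<open>(t, s\<^sub>0)\<close>, where \<open>s\<^sub>0\<close> is an end point of \<open>I\<close>: a genuine one-sided derivative for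
  \<open>0 < t < 1\<close>, extended by continuity to \<open>t = 0\<close> and \<open>t = 1\<close>. Such a \<open>d\<close> is unique on \<open>I\<close>.
\<close>

definition has_boundary_ds :: "(real \<Rightarrow> real \<Rightarrow> real) \<Rightarrow> real \<Rightarrow> (real \<Rightarrow> real) \<Rightarrow> bool" where
  "has_boundary_ds G s\<^sub>0 d \<longleftrightarrow>
     (\<forall>t\<in>{0<..<1}. (G t has_real_derivative d t) (at s\<^sub>0 within I)) \<and>
     (d \<longlongrightarrow> d 0) (at_right 0) \<and> (d \<longlongrightarrow> d 1) (at_left 1)"

end

theory Submission
  imports Defs
begin

text \<open>
  For every continuous source \<open>\<sigma>\<close> let \<open>u\<^sub>P\<close> and \<open>u\<^sub>D\<close> be the periodic and the Dirichlet solution of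
  \<open>L u = \<sigma>\<close>. The function \<open>u\<^sub>D + u\<^sub>P(1) (r\<^sub>1 + r\<^sub>2)\<close> solves the same equation as \<open>u\<^sub>P\<close> and has the same
  boundary values, because \<open>u\<^sub>P(0) = u\<^sub>P(1)\<close>; Dirichlet nonresonance makes the two equal. Written with
  the Green's functions, this says that a continuous kernel is orthogonal to every continuous
  \<open>\<sigma>\<close>, so the kernel vanishes: this is the first identity
  (\<open>periodic_green_function_decomposition\<close>).

  The second identity needs the boundary derivatives of \<open>G\<^sub>D\<close>, which are read off from the explicit
  formula \<open>G\<^sub>D(t,s) = - r\<^sub>1(max t s) r\<^sub>2(min t s) / w\<close>. Here \<open>w\<close> is the Wronskian
  \<open>r\<^sub>1 r\<^sub>2' - r\<^sub>1' r\<^sub>2\<close>, a constant, equal to \<open>r\<^sub>2'(0)\<close> and to \<open>- r\<^sub>1'(1)\<close>; hence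
  \<open>\<partial>\<^sub>s G\<^sub>D(t,0) = - r\<^sub>1(t)\<close> and \<open>\<partial>\<^sub>s G\<^sub>D(t,1) = r\<^sub>2(t)\<close>. The formula follows
  from the same orthogonality argument once variation of parameters shows that the kernel produces
  Dirichlet solutions (\<open>Dirichlet_kernel_solution\<close>, \<open>Dirichlet_green_function_eq_kernel\<close>). The
  Wronskian is nonzero since otherwise \<open>r\<^sub>2\<close> would have zero initial values at \<open>0\<close> and vanish
  (\<open>solution_zero_initial_values\<close>).

  As \<open>a\<close> is merely integrable, all of this happens up to null sets and rests on two facts about
  absolutely continuous functions: they are differentiable almost everywhere
  (\<open>AC_differentiable_AE\<close>), without which \<open>L\<close> would not even be additive up to null sets, and they
  satisfy the fundamental theorem of calculus
  (\<open>AC_fundamental_theorem_of_calculus\<close>), which gives the constancy of the Wronskian and the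
  uniqueness for the initial value problem.
\<close>

section \<open>Total variation of absolutely continuous functions\<close>

definition variation_sums :: "(real \<Rightarrow> real) \<Rightarrow> real \<Rightarrow> real set" where
  "variation_sums f x =
     {(\<Sum>k<n. \<bar>f (p (Suc k)) - f (p k)\<bar>) | n p. mono p \<and> p (0::nat) = 0 \<and> p n = x}"

definition variation :: "(real \<Rightarrow> real) \<Rightarrow> real \<Rightarrow> real" where
  "variation f x = Sup (variation_sums f x)"

text \<open>
  Append the point \<open>y\<close> to a partition. Passing to suprema, this makes the variation superadditive,
  so that it dominates the increments of \<open>f\<close>.
\<close>

lemma variation_sums_extend:
  assumes "s \<in> variation_sums f x" "x \<le> y"
  shows "s + \<bar>f y - f x\<bar> \<in> variation_sums f y"
proof -
  obtain n p where p: "mono p" "p 0 = 0" "p n = x" and s: "s = (\<Sum>k<n. \<bar>f (p (Suc k)) - f (p k)\<bar>)"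
    using assms(1) unfolding variation_sums_def by blast
  define q where "q = (\<lambda>k. if k \<le> n then p k else y)"
  have "mono q"
    unfolding q_def using p assms(2) by (auto simp: mono_def) (meson order_trans)
  moreover have "q 0 = 0" "q (Suc n) = y" by (auto simp: q_def p)
  moreover have "s + \<bar>f y - f x\<bar> = (\<Sum>k<Suc n. \<bar>f (q (Suc k)) - f (q k)\<bar>)"
    using s p by (simp add: q_def)
  ultimately show ?thesis unfolding variation_sums_def by blast
qed

lemma zero_in_variation_sums: "0 \<in> variation_sums f 0"
  unfolding variation_sums_def by (force intro!: exI[of _ 0] exI[of _ "\<lambda>_. 0"] simp: mono_def)

text \<open>
  Divide \<open>[0,1]\<close> into cells of length \<open>1/N < \<delta>\<close>, where \<open>\<delta>\<close> belongs to \<open>\<epsilon> = 1\<close>. A partition may straddle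
  cells, so an induction cuts it at the cell boundaries \<open>z = j/N\<close>; each cell contributes at most
  \<open>1\<close> to the sum.
\<close>

lemma AC_bounded_variation:
  assumes "f \<in> AC"
  shows "bdd_above (variation_sums f 1)"
proof -
  obtain \<delta> where "\<delta> > 0" and \<delta>: "\<And>(n::nat) x y.
     (\<forall>k<n. 0 \<le> x k \<and> x k \<le> y k \<and> y k \<le> 1) \<Longrightarrow>
     disjoint_family_on (\<lambda>k. {x k<..<y k}) {..<n} \<Longrightarrow>
     (\<Sum>k<n. y k - x k) < \<delta> \<Longrightarrow> (\<Sum>k<n. \<bar>f (y k) - f (x k)\<bar>) < 1"
    using assms[unfolded AC_def mem_Collect_eq, rule_format, OF zero_less_one] by blast
  obtain N :: nat where N: "N > 0" "1 / real N < \<delta>"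
    using \<open>\<delta> > 0\<close> real_arch_inverse[of \<delta>] by (auto simp: inverse_eq_divide)
  have short: "(\<Sum>k<n. \<bar>f (p (Suc k)) - f (p k)\<bar>) < 1"
    if "mono p" "0 \<le> p 0" "p n \<le> 1" "p n - p 0 < \<delta>" for p :: "nat \<Rightarrow> real" and n
  proof (rule \<delta>)
    show "\<forall>k<n. 0 \<le> p k \<and> p k \<le> p (Suc k) \<and> p (Suc k) \<le> 1"
      using that by (smt (verit, best) Suc_leI bot_nat_0.extremum lessI less_imp_le_nat monoD)
    show "disjoint_family_on (\<lambda>k. {p k<..<p (Suc k)}) {..<n}"
      unfolding disjoint_family_on_def
    proof (intro ballI impI)
      fix k l :: nat assume "k \<noteq> l"
      then have "p (Suc k) \<le> p l \<or> p (Suc l) \<le> p k"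
        using \<open>mono p\<close> by (metis Suc_leI linorder_neqE_nat monoD)
      then show "{p k<..<p (Suc k)} \<inter> {p l<..<p (Suc l)} = {}" by auto
    qed
    have "(\<Sum>k<n. p (Suc k) - p k) = p n - p 0" by (rule sum_lessThan_telescope)
    then show "(\<Sum>k<n. p (Suc k) - p k) < \<delta>" using that by simp
  qed
  have *: "(\<Sum>k<n. \<bar>f (p (Suc k)) - f (p k)\<bar>) \<le> real (Suc j)"
    if "mono p" "0 \<le> p 0" "p n \<le> real j / real N" "j \<le> N" for p :: "nat \<Rightarrow> real" and n j
    using that
  proof (induction j arbitrary: p)
    case 0
    have "p n - p 0 < \<delta>" "p n \<le> 1" using 0 \<open>\<delta> > 0\<close> by auto
    then show ?case using short[OF 0(1,2), of n] by simp
  next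
    case (Suc j)
    define z where "z = real j / real N"
    have z: "0 \<le> z" "z \<le> 1" using Suc.prems N by (auto simp: z_def)
    have zS: "real (Suc j) / real N = z + 1 / real N" by (simp add: z_def add_divide_distrib)
    have le1: "real (Suc j) / real N \<le> 1" using Suc.prems N by auto
    \<comment> \<open>Cutting at \<open>z\<close> is exact, by \<open>f y = f (min y z) + f (max y z) - f z\<close>, so the triangle
      inequality suffices.\<close>
    have split: "\<bar>f (p (Suc k)) - f (p k)\<bar> \<le> \<bar>f (min (p (Suc k)) z) - f (min (p k) z)\<bar>
       + \<bar>f (max (p (Suc k)) z) - f (max (p k) z)\<bar>" for k :: nat
      by (smt (verit) max_def min_def)
    have "(\<Sum>k<n. \<bar>f (p (Suc k)) - f (p k)\<bar>) \<le> (\<Sum>k<n. \<bar>f (min (p (Suc k)) z) - f (min (p k) z)\<bar>)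
       + (\<Sum>k<n. \<bar>f (max (p (Suc k)) z) - f (max (p k) z)\<bar>)"
      unfolding sum.distrib[symmetric] by (rule sum_mono) (rule split)
    moreover have "(\<Sum>k<n. \<bar>f (min (p (Suc k)) z) - f (min (p k) z)\<bar>) \<le> real (Suc j)"
      using Suc.prems z by (intro Suc.IH[of "\<lambda>k. min (p k) z"]) (auto simp: z_def mono_def intro: min.coboundedI1)
    moreover have "(\<Sum>k<n. \<bar>f (max (p (Suc k)) z) - f (max (p k) z)\<bar>) < 1"
    proof (rule short[of "\<lambda>k. max (p k) z"])
      show "mono (\<lambda>k. max (p k) z)"
        using Suc.prems by (auto simp: mono_def intro: max.coboundedI1)
      show "max (p n) z \<le> 1" using order_trans[OF Suc.prems(3) le1] z by simp
      show "max (p n) z - max (p 0) z < \<delta>" using Suc.prems(3) N(2) zS \<open>\<delta> > 0\<close> unfolding max_def by (auto simp del: of_nat_Suc)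
    qed (use z in auto)
    ultimately show ?case by simp
  qed
  show ?thesis
  proof (rule bdd_aboveI)
    fix s assume "s \<in> variation_sums f 1"
    then obtain n p where p: "mono p" "p 0 = 0" "p n = 1" and s: "s = (\<Sum>k<n. \<bar>f (p (Suc k)) - f (p k)\<bar>)"
      unfolding variation_sums_def by blast
    show "s \<le> real (Suc N)" using *[of p n N] p s N by simp
  qed
qed

lemma abs_diff_le_variation_diff:
  assumes bv: "bdd_above (variation_sums f 1)" and xy: "0 \<le> x" "x \<le> y" "y \<le> 1"
  shows "\<bar>f y - f x\<bar> \<le> variation f y - variation f x"
proof -
  have bdd: "bdd_above (variation_sums f y)"
  proof -
    obtain B where B: "\<And>s. s \<in> variation_sums f 1 \<Longrightarrow> s \<le> B" using bv by (auto simp: bdd_above_def)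
    show ?thesis
      using B variation_sums_extend[OF _ \<open>y \<le> 1\<close>, of _ f]
      by (intro bdd_aboveI[of _ B]) (smt (verit))
  qed
  have ne: "variation_sums f x \<noteq> {}"
    using variation_sums_extend[OF zero_in_variation_sums \<open>0 \<le> x\<close>] by blast
  have "variation f x \<le> variation f y - \<bar>f y - f x\<bar>"
    unfolding variation_def
    using cSup_upper[OF variation_sums_extend[OF _ \<open>x \<le> y\<close>] bdd]
    by (intro cSup_least[OF ne]) (smt (verit))
  then show ?thesis by simp
qed

text \<open>
  Induction on the number of intervals: split off the rightmost one; the others lie to its left.
\<close>

lemma sum_disjoint_increments_le:
  fixes g l u :: "_ \<Rightarrow> real"
  assumes "finite C" and mono: "mono_on {a..b} g" and ab: "a \<le> b"
    and "\<And>i. i \<in> C \<Longrightarrow> a \<le> l i \<and> l i < u i \<and> u i \<le> b"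
    and "pairwise (\<lambda>i j. disjnt {l i..u i} {l j..u j}) C"
  shows "(\<Sum>i\<in>C. g (u i) - g (l i)) \<le> g b - g a"
  using assms
proof (induction "card C" arbitrary: C b)
  case 0
  then show ?case by (auto simp: mono_on_def)
next
  case (Suc n)
  have ne: "C \<noteq> {}" using Suc.hyps(2) by auto
  obtain i where i: "i \<in> C" "\<And>j. j \<in> C \<Longrightarrow> u j \<le> u i"
    using finite_imageI[OF Suc.prems(1), of u] ne Max_in[of "u ` C"] Max_ge[of "u ` C"]
    by (metis (no_types, lifting) imageE imageI image_is_empty)
  have lu: "a \<le> l i" "l i < u i" "u i \<le> b" using Suc.prems(4)[OF i(1)] by auto
  have below: "u j < l i" if "j \<in> C - {i}" for j
  proof (rule ccontr)
    assume "\<not> u j < l i"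
    moreover have "disjnt {l j..u j} {l i..u i}" using Suc.prems(5) that i(1) by (auto simp: pairwise_def)
    moreover have "u j \<le> u i" "l j < u j" using that i(2) Suc.prems(4) by auto
    ultimately show False by (auto simp: disjnt_def disjoint_iff)
  qed
  have "(\<Sum>j\<in>C - {i}. g (u j) - g (l j)) \<le> g (l i) - g a"
  proof (rule Suc.hyps(1))
    show "n = card (C - {i})" using Suc.hyps(2) i(1) Suc.prems(1) by simp
    show "mono_on {a..l i} g" using Suc.prems(2) lu by (auto intro: mono_on_subset)
    show "a \<le> l j \<and> l j < u j \<and> u j \<le> l i" if "j \<in> C - {i}" for j
      using Suc.prems(4)[of j] below[OF that] that by auto
    show "pairwise (\<lambda>i j. disjnt {l i..u i} {l j..u j}) (C - {i})"
      using Suc.prems(5) by (rule pairwise_subset) auto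
  qed (use Suc.prems(1) lu in auto)
  moreover have "g (u i) \<le> g b" using Suc.prems(2) lu by (auto simp: mono_on_def)
  moreover have "(\<Sum>j\<in>C. g (u j) - g (l j)) = g (u i) - g (l i) + (\<Sum>j\<in>C - {i}. g (u j) - g (l j))"
    using i(1) Suc.prems(1) by (simp add: sum.remove)
  ultimately show ?case by linarith
qed

text \<open>
  The form in which Vitali's covering theorem is applied: to bound the outer measure of \<open>S\<close> it
  suffices to bound the total length of finite disjoint families from a fine cover.
\<close>

lemma Vitali_interval_cover:
  fixes S :: "real set" and K :: "(real \<times> real) set"
  assumes cover: "\<And>x d. x \<in> S \<Longrightarrow> d > 0 \<Longrightarrow> \<exists>u v. (u, v) \<in> K \<and> x \<in> {u..v} \<and> v - u < d"
    and K: "\<And>u v. (u, v) \<in> K \<Longrightarrow> u < v"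
    and B: "\<And>F. finite F \<Longrightarrow> F \<subseteq> K \<Longrightarrow> pairwise (\<lambda>i j. disjnt {fst i..snd i} {fst j..snd j}) F
               \<Longrightarrow> (\<Sum>i\<in>F. snd i - fst i) \<le> B"
  shows "\<exists>T. S \<subseteq> T \<and> T \<in> lmeasurable \<and> measure lebesgue T \<le> B"
proof -
  define c where "c = (\<lambda>i::real\<times>real. (fst i + snd i) / 2)"
  define r where "r = (\<lambda>i::real\<times>real. (snd i - fst i) / 2)"
  have ball: "cball (c i) (r i) = {fst i..snd i}" for i
    by (auto simp: c_def r_def cball_eq_atLeastAtMost field_simps)
  obtain C where C: "countable C" "C \<subseteq> K"
    "pairwise (\<lambda>i j. disjnt (cball (c i) (r i)) (cball (c j) (r j))) C"
    "negligible (S - (\<Union>i\<in>C. cball (c i) (r i)))"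
  proof (rule Vitali_covering_theorem_cballs[of K r S c])
    show "0 < r i" if "i \<in> K" for i using K[of "fst i" "snd i"] that by (simp add: r_def)
    show "\<exists>i. i \<in> K \<and> x \<in> cball (c i) (r i) \<and> r i < d" if xd: "x \<in> S" "0 < d" for x d
    proof -
      obtain u v where "(u, v) \<in> K" "x \<in> {u..v}" "v - u < d" using cover[OF xd] by blast
      then show ?thesis using K[of u v] unfolding ball by (intro exI[of _ "(u, v)"]) (auto simp: r_def)
    qed
  qed
  define U where "U = (\<Union>i\<in>C. {fst i..snd i})"
  have Un: "U = \<Union>((\<lambda>i. {fst i..snd i}) ` C)" by (simp add: U_def)
  have fin: "measure lebesgue (\<Union>\<D>) \<le> B" if \<D>: "\<D> \<subseteq> (\<lambda>i. {fst i..snd i}) ` C" "finite \<D>" for \<D>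
  proof -
    obtain F where F: "F \<subseteq> C" "finite F" "\<D> = (\<lambda>i. {fst i..snd i}) ` F"
      using finite_subset_image[OF \<D>(2,1)] by blast
    have "measure lebesgue (\<Union>\<D>) \<le> (\<Sum>i\<in>F. measure lebesgue {fst i..snd i})"
      unfolding F(3) by (intro measure_UNION_le) (use F in auto)
    also have "\<dots> = (\<Sum>i\<in>F. snd i - fst i)"
      using F C(2) K by (intro sum.cong) (auto, metis less_imp_le prod.collapse subsetD)
    also have "\<dots> \<le> B"
      using F C pairwise_subset[OF C(3) F(1)] by (intro B) (auto simp: ball)
    finally show ?thesis .
  qed
  have U: "U \<in> lmeasurable" "measure lebesgue U \<le> B"
    using fmeasurable_Union_bound[of "(\<lambda>i. {fst i..snd i}) ` C" lebesgue B] C(1) fin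
      measure_Union_bound[of "(\<lambda>i. {fst i..snd i}) ` C" lebesgue B] 
    unfolding Un by auto
  have neg: "negligible (S - U)" using C(4) by (simp add: U_def ball)
  have "U \<union> (S - U) \<in> lmeasurable" by (rule fmeasurable.Un[OF U(1) negligible_imp_measurable[OF neg]])
  moreover have "measure lebesgue (U \<union> (S - U)) = measure lebesgue U"
    using measure_Un_null_set[of U lebesgue "S - U"] neg U(1)
    by (simp only: negligible_iff_null_sets fmeasurableD)
  ultimately show ?thesis using U by (intro exI[of _ "U \<union> (S - U)"]) auto
qed

section \<open>Closure properties of absolutely continuous functions\<close>

text \<open>
  One comparison principle from which linear combinations, products, continuously differentiable
  functions and functions modified outside \<open>I\<close> are all seen to be absolutely continuous.
\<close>

lemma AC_dominated:
  assumes f: "f \<in> AC" and g: "g \<in> AC"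
    and h: "\<And>x y. 0 \<le> x \<Longrightarrow> x \<le> y \<Longrightarrow> y \<le> 1 \<Longrightarrow> \<bar>h y - h x\<bar> \<le> A * \<bar>f y - f x\<bar> + B * \<bar>g y - g x\<bar>"
  shows "h \<in> AC"
  unfolding AC_def mem_Collect_eq
proof (intro allI impI)
  fix \<epsilon> :: real assume "\<epsilon> > 0"
  define \<eta> where "\<eta> = \<epsilon> / (\<bar>A\<bar> + \<bar>B\<bar> + 1)"
  have "\<eta> > 0" using \<open>\<epsilon> > 0\<close> by (auto simp: \<eta>_def intro!: divide_pos_pos)
  obtain \<delta>1 where d1: "\<delta>1 > 0" "\<And>(n::nat) x y. (\<forall>k<n. 0 \<le> x k \<and> x k \<le> y k \<and> y k \<le> 1) \<and>
     disjoint_family_on (\<lambda>k. {x k<..<y k}) {..<n} \<and> (\<Sum>k<n. y k - x k) < \<delta>1 \<Longrightarrow>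
     (\<Sum>k<n. \<bar>f (y k) - f (x k)\<bar>) < \<eta>"
    using f[unfolded AC_def mem_Collect_eq, rule_format, OF \<open>\<eta> > 0\<close>] by blast
  obtain \<delta>2 where d2: "\<delta>2 > 0" "\<And>(n::nat) x y. (\<forall>k<n. 0 \<le> x k \<and> x k \<le> y k \<and> y k \<le> 1) \<and>
     disjoint_family_on (\<lambda>k. {x k<..<y k}) {..<n} \<and> (\<Sum>k<n. y k - x k) < \<delta>2 \<Longrightarrow>
     (\<Sum>k<n. \<bar>g (y k) - g (x k)\<bar>) < \<eta>"
    using g[unfolded AC_def mem_Collect_eq, rule_format, OF \<open>\<eta> > 0\<close>] by blast
  show "\<exists>\<delta>>0. \<forall>(n::nat) x y. (\<forall>k<n. 0 \<le> x k \<and> x k \<le> y k \<and> y k \<le> 1) \<and>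
     disjoint_family_on (\<lambda>k. {x k<..<y k}) {..<n} \<and> (\<Sum>k<n. y k - x k) < \<delta> \<longrightarrow>
     (\<Sum>k<n. \<bar>h (y k) - h (x k)\<bar>) < \<epsilon>"
  proof (intro exI[of _ "min \<delta>1 \<delta>2"] conjI allI impI)
    fix n :: nat and x y :: "nat \<Rightarrow> real"
    assume *: "(\<forall>k<n. 0 \<le> x k \<and> x k \<le> y k \<and> y k \<le> 1) \<and>
     disjoint_family_on (\<lambda>k. {x k<..<y k}) {..<n} \<and> (\<Sum>k<n. y k - x k) < min \<delta>1 \<delta>2"
    have F: "(\<Sum>k<n. \<bar>f (y k) - f (x k)\<bar>) < \<eta>" and G: "(\<Sum>k<n. \<bar>g (y k) - g (x k)\<bar>) < \<eta>"
      using * d1(2)[of n x y] d2(2)[of n x y] by auto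
    have F0: "0 \<le> (\<Sum>k<n. \<bar>f (y k) - f (x k)\<bar>)" and G0: "0 \<le> (\<Sum>k<n. \<bar>g (y k) - g (x k)\<bar>)"
      by (auto intro: sum_nonneg)
    have "(\<Sum>k<n. \<bar>h (y k) - h (x k)\<bar>) \<le> (\<Sum>k<n. A * \<bar>f (y k) - f (x k)\<bar> + B * \<bar>g (y k) - g (x k)\<bar>)"
      using * by (intro sum_mono h) auto
    also have "\<dots> = A * (\<Sum>k<n. \<bar>f (y k) - f (x k)\<bar>) + B * (\<Sum>k<n. \<bar>g (y k) - g (x k)\<bar>)"
      by (simp add: sum.distrib sum_distrib_left)
    also have "\<dots> \<le> \<bar>A\<bar> * \<eta> + \<bar>B\<bar> * \<eta>"
      using F G F0 G0 by (intro add_mono) (smt (verit) mult_mono' mult_right_mono)+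
    also have "\<dots> < (\<bar>A\<bar> + \<bar>B\<bar> + 1) * \<eta>" using \<open>\<eta> > 0\<close> by (simp add: algebra_simps)
    also have "\<dots> = \<epsilon>" by (simp add: \<eta>_def add_nonneg_pos less_imp_neq[symmetric])
    finally show "(\<Sum>k<n. \<bar>h (y k) - h (x k)\<bar>) < \<epsilon>" .
  qed (use d1 d2 in auto)
qed

lemma AC_ident: "(\<lambda>x. x) \<in> AC"
  unfolding AC_def mem_Collect_eq
proof (intro allI impI exI conjI)
  fix \<epsilon> :: real and n :: nat and x y :: "nat \<Rightarrow> real"
  assume "\<epsilon> > 0" and *: "(\<forall>k<n. 0 \<le> x k \<and> x k \<le> y k \<and> y k \<le> 1) \<and>
     disjoint_family_on (\<lambda>k. {x k<..<y k}) {..<n} \<and> (\<Sum>k<n. y k - x k) < \<epsilon>"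
  have "(\<Sum>k<n. \<bar>y k - x k\<bar>) = (\<Sum>k<n. y k - x k)" using * by (intro sum.cong) auto
  then show "(\<Sum>k<n. \<bar>y k - x k\<bar>) < \<epsilon>" using * by simp
qed

lemma AC_lincomb:
  assumes "f \<in> AC" "g \<in> AC" shows "(\<lambda>x. A * f x + B * g x) \<in> AC"
proof (rule AC_dominated[OF assms, of _ "\<bar>A\<bar>" "\<bar>B\<bar>"])
  fix x y
  have "A * f y + B * g y - (A * f x + B * g x) = A * (f y - f x) + B * (g y - g x)"
    by (simp add: algebra_simps)
  then show "\<bar>A * f y + B * g y - (A * f x + B * g x)\<bar> \<le> \<bar>A\<bar> * \<bar>f y - f x\<bar> + \<bar>B\<bar> * \<bar>g y - g x\<bar>"
    by (metis abs_mult abs_triangle_ineq)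
qed

lemma AC_continuous_on:
  assumes "f \<in> AC" shows "continuous_on I f"
  unfolding continuous_on_iff
proof (intro ballI allI impI)
  fix x \<epsilon> :: real assume x: "x \<in> I" and "\<epsilon> > 0"
  obtain \<delta> where d: "\<delta> > 0" "\<And>(n::nat) x y. (\<forall>k<n. 0 \<le> x k \<and> x k \<le> y k \<and> y k \<le> 1) \<and>
     disjoint_family_on (\<lambda>k. {x k<..<y k}) {..<n} \<and> (\<Sum>k<n. y k - x k) < \<delta> \<Longrightarrow>
     (\<Sum>k<n. \<bar>f (y k) - f (x k)\<bar>) < \<epsilon>"
    using assms[unfolded AC_def mem_Collect_eq, rule_format, OF \<open>\<epsilon> > 0\<close>] by blast
  have "dist (f z) (f x) < \<epsilon>" if z: "z \<in> I" "dist z x < \<delta>" for z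
    using d(2)[of 1 "\<lambda>_. min x z" "\<lambda>_. max x z"] x z
    by (cases "x \<le> z") (auto simp: dist_real_def disjoint_family_on_def abs_minus_commute)
  then show "\<exists>d>0. \<forall>x'\<in>I. dist x' x < d \<longrightarrow> dist (f x') (f x) < \<epsilon>" using d(1) by blast
qed

lemma AC_mult:
  assumes "f \<in> AC" "g \<in> AC" shows "(\<lambda>x. f x * g x) \<in> AC"
proof -
  obtain A where A: "\<And>x. x \<in> I \<Longrightarrow> \<bar>f x\<bar> \<le> A"
    using compact_imp_bounded[OF compact_continuous_image[OF AC_continuous_on[OF assms(1)] compact_Icc]]
    unfolding bounded_iff by (metis imageI real_norm_def)
  obtain B where B: "\<And>x. x \<in> I \<Longrightarrow> \<bar>g x\<bar> \<le> B"
    using compact_imp_bounded[OF compact_continuous_image[OF AC_continuous_on[OF assms(2)] compact_Icc]]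
    unfolding bounded_iff by (metis imageI real_norm_def)
  show ?thesis
  proof (rule AC_dominated[OF assms, of _ B A])
    fix x y :: real assume *: "0 \<le> x" "x \<le> y" "y \<le> 1"
    have "f y * g y - f x * g x = g y * (f y - f x) + f x * (g y - g x)" by (simp add: algebra_simps)
    then have "\<bar>f y * g y - f x * g x\<bar> \<le> \<bar>g y\<bar> * \<bar>f y - f x\<bar> + \<bar>f x\<bar> * \<bar>g y - g x\<bar>"
      by (metis abs_mult abs_triangle_ineq)
    also have "\<dots> \<le> B * \<bar>f y - f x\<bar> + A * \<bar>g y - g x\<bar>"
      using A[of x] B[of y] * by (intro add_mono mult_right_mono) auto
    finally show "\<bar>f y * g y - f x * g x\<bar> \<le> B * \<bar>f y - f x\<bar> + A * \<bar>g y - g x\<bar>" .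
  qed
qed

section \<open>Differentiability almost everywhere\<close>

lemma slope_interval:
  assumes "(y::real) \<noteq> x"
  shows "(f y - f x) / (y - x) = (f (max x y) - f (min x y)) / (max x y - min x y)"
  using assms by (auto simp: max_def min_def divide_simps) (auto simp: algebra_simps)

text \<open>
  An interval on which the slope exceeds \<open>M\<close> in modulus carries at least \<open>M\<close> times its length of the
  total variation. Disjoint intervals of this kind have total length at most \<open>V(1)/M\<close>, which is
  arbitrarily small.
\<close>

lemma negligible_unbounded_slopes:
  assumes "f \<in> AC"
  shows "negligible {x \<in> I. \<forall>M d. d > 0 \<longrightarrow> (\<exists>y\<in>I. y \<noteq> x \<and> \<bar>y - x\<bar> < d \<and> \<bar>(f y - f x) / (y - x)\<bar> > M)}"
    (is "negligible ?S")
  unfolding negligible_outer_le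
proof (intro allI impI)
  fix e :: real assume "e > 0"
  define V where "V = variation f"
  have V: "\<bar>f y - f x\<bar> \<le> V y - V x" if "0 \<le> x" "x \<le> y" "y \<le> 1" for x y
    unfolding V_def using AC_bounded_variation[OF assms] that by (rule abs_diff_le_variation_diff)
  then have mono: "mono_on I V" by (force simp: mono_on_def)
  \<comment> \<open>The summand 1 only serves to make \<open>M\<close> positive when \<open>V\<close> is constant.\<close>
  define M where "M = (V 1 - V 0) / e + 1"
  have "V 0 \<le> V 1" using V[of 0 1] by auto
  then have "M > 0" using \<open>e > 0\<close> by (simp add: M_def add_nonneg_pos)
  show "\<exists>T. ?S \<subseteq> T \<and> T \<in> lmeasurable \<and> measure lebesgue T \<le> e"
  proof (rule Vitali_interval_cover[where K = "{(u, v). 0 \<le> u \<and> u < v \<and> v \<le> 1 \<and> M * (v - u) \<le> V v - V u}"])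
    fix x d :: real assume x: "x \<in> ?S" and "d > 0"
    then obtain y where y: "y \<in> I" "y \<noteq> x" "\<bar>y - x\<bar> < d" "\<bar>(f y - f x) / (y - x)\<bar> > M" by blast
    define u v where "u = min x y" and "v = max x y"
    have uv: "u < v" "0 \<le> u" "v \<le> 1" "v - u < d" "x \<in> {u..v}"
      using x y by (auto simp: u_def v_def)
    have "M * (v - u) < \<bar>f v - f u\<bar>"
      using y(4) uv(1) unfolding slope_interval[OF y(2)] u_def[symmetric] v_def[symmetric]
      by (simp add: abs_divide pos_less_divide_eq)
    then have "M * (v - u) \<le> V v - V u" using V[of u v] uv by auto
    with uv show "\<exists>u v. (u, v) \<in> {(u, v). 0 \<le> u \<and> u < v \<and> v \<le> 1 \<and> M * (v - u) \<le> V v - V u} \<and>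
                x \<in> {u..v} \<and> v - u < d" by blast
  next
    fix F :: "(real \<times> real) set"
    assume F: "finite F" "F \<subseteq> {(u, v). 0 \<le> u \<and> u < v \<and> v \<le> 1 \<and> M * (v - u) \<le> V v - V u}"
      "pairwise (\<lambda>i j. disjnt {fst i..snd i} {fst j..snd j}) F"
    have "M * (\<Sum>i\<in>F. snd i - fst i) \<le> (\<Sum>i\<in>F. V (snd i) - V (fst i))"
      unfolding sum_distrib_left using F(2) by (intro sum_mono) auto
    also have "\<dots> \<le> V 1 - V 0"
      using F by (intro sum_disjoint_increments_le[OF F(1) mono]) auto
    also have "\<dots> \<le> M * e" using \<open>e > 0\<close> by (simp add: M_def field_simps)
    finally show "(\<Sum>i\<in>F. snd i - fst i) \<le> e" using \<open>M > 0\<close> by simp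
  qed auto
qed

text \<open>
  Choose a partition whose sum misses the total variation by less than \<open>2 c e\<close>. In each cell take
  intervals whose slope has the sign opposite to the increment of \<open>f\<close> over the cell. With \<open>s\<^sub>k\<close> the
  sign of that increment, \<open>G\<^sub>k = V - s\<^sub>k f\<close> is nondecreasing, it grows by at least \<open>2 c\<close> times the length
  over each such interval, and its growth over all cells together is what the partition misses.
  So the chosen intervals have total length at most \<open>e\<close>.
\<close>

lemma negligible_oscillating_slopes:
  assumes "f \<in> AC" "c > 0"
  shows "negligible {x \<in> I. \<forall>d>0. (\<exists>y\<in>I. y \<noteq> x \<and> \<bar>y - x\<bar> < d \<and> (f y - f x) / (y - x) > c) \<and>
                                 (\<exists>y\<in>I. y \<noteq> x \<and> \<bar>y - x\<bar> < d \<and> (f y - f x) / (y - x) < - c)}"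
    (is "negligible ?S")
  unfolding negligible_outer_le
proof (intro allI impI)
  fix e :: real assume "e > 0"
  define V where "V = variation f"
  have bdd: "bdd_above (variation_sums f 1)" by (rule AC_bounded_variation) fact
  have V: "\<bar>f y - f x\<bar> \<le> V y - V x" if "0 \<le> x" "x \<le> y" "y \<le> 1" for x y
    unfolding V_def using bdd that by (rule abs_diff_le_variation_diff)
  have V0: "V 0 \<ge> 0"
  proof -
    obtain B where B: "\<And>s. s \<in> variation_sums f 1 \<Longrightarrow> s \<le> B" using bdd by (auto simp: bdd_above_def)
    have "bdd_above (variation_sums f 0)"
      using B variation_sums_extend[of _ f 0 1] by (intro bdd_aboveI[of _ B]) (smt (verit))
    then show ?thesis unfolding V_def variation_def by (rule cSup_upper[OF zero_in_variation_sums])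
  qed
  have "\<exists>s\<in>variation_sums f 1. V 1 - 2 * c * e < s"
  proof -
    have "variation_sums f 1 \<noteq> {}" using variation_sums_extend[OF zero_in_variation_sums, of 1 f] by auto
    then show ?thesis
      using less_cSup_iff[OF _ bdd, of "V 1 - 2 * c * e"] \<open>e > 0\<close> \<open>c > 0\<close>
      by (simp add: V_def variation_def)
  qed
  then obtain n p where p: "mono p" "p 0 = 0" "p n = 1"
    and near: "V 1 - 2 * c * e < (\<Sum>k<n. \<bar>f (p (Suc k)) - f (p k)\<bar>)"
    unfolding variation_sums_def by blast
  have pI: "0 \<le> p k" "k \<le> n \<Longrightarrow> p k \<le> 1" "p k \<le> p (Suc k)" for k
    using p monoD[OF p(1), of 0 k] monoD[OF p(1), of k n] monoD[OF p(1), of k "Suc k"] by auto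
  define s where "s = (\<lambda>k. if f (p (Suc k)) \<ge> f (p k) then 1 else - 1 :: real)"
  define G where "G = (\<lambda>k x. V x - s k * f x)"
  have mono: "mono_on {p k..p (Suc k)} (G k)" if "k < n" for k
  proof (rule mono_onI)
    fix x y assume *: "x \<in> {p k..p (Suc k)}" "y \<in> {p k..p (Suc k)}" "x \<le> y"
    have "0 \<le> x" "y \<le> 1" using * pI(1)[of k] pI(2)[of "Suc k"] that by auto
    then show "G k x \<le> G k y" using V[of x y] * by (auto simp: G_def s_def)
  qed
  define K where "K = {(u, v). u < v \<and> (\<exists>k<n. p k \<le> u \<and> v \<le> p (Suc k) \<and> 2 * c * (v - u) \<le> G k v - G k u)}"
  have "\<exists>T. ?S - p ` {..n} \<subseteq> T \<and> T \<in> lmeasurable \<and> measure lebesgue T \<le> e"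
  proof (rule Vitali_interval_cover[where K = K])
    fix x d :: real assume x: "x \<in> ?S - p ` {..n}" and "d > 0"
    define k where "k = (LEAST k. x < p (Suc k))"
    have xp: "x \<noteq> p k" if "k \<le> n" for k using x that by auto
    have "n > 0" using p by (metis gr0I zero_neq_one)
    have x1: "x < p (Suc (n - 1))" using xp[of n] x p \<open>n > 0\<close> by auto
    have k: "x < p (Suc k)" "k \<le> n - 1" unfolding k_def using x1 by (auto intro: LeastI Least_le)
    then have kn: "k < n" using \<open>n > 0\<close> by simp
    have "p k \<le> x"
    proof (cases k)
      case 0 then show ?thesis using x p by auto
    next
      case (Suc j)
      then have "\<not> x < p (Suc j)" unfolding k_def using not_less_Least[of j "\<lambda>k. x < p (Suc k)"] by simp
      then show ?thesis using Suc by simp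
    qed
    with xp[of k] kn have "p k < x" by auto
    \<comment> \<open>Staying within \<open>d'\<close> of \<open>x\<close> keeps the interval inside the cell that contains \<open>x\<close>.\<close>
    define d' where "d' = min d (min (x - p k) (p (Suc k) - x))"
    have "d' > 0" using \<open>d > 0\<close> \<open>p k < x\<close> k by (simp add: d'_def)
    define q where "q = (\<lambda>y. (f y - f x) / (y - x))"
    obtain y where y: "y \<in> I" "y \<noteq> x" "\<bar>y - x\<bar> < d'" "s k * q y < - c"
    proof (cases "s k = 1")
      case True
      have "\<exists>y\<in>I. y \<noteq> x \<and> \<bar>y - x\<bar> < d' \<and> q y < - c"
        using x \<open>d' > 0\<close> unfolding q_def by blast
      with that True show ?thesis by (metis mult_1)
    next
      case False
      have "\<exists>y\<in>I. y \<noteq> x \<and> \<bar>y - x\<bar> < d' \<and> q y > c"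
        using x \<open>d' > 0\<close> unfolding q_def by blast
      moreover have "s k = - 1" using False by (auto simp: s_def)
      ultimately show ?thesis using that by (metis mult_minus1 neg_less_iff_less)
    qed
    define u v where "u = min x y" and "v = max x y"
    have uv: "u < v" "p k \<le> u" "v \<le> p (Suc k)" "v - u < d" "x \<in> {u..v}" "0 \<le> u" "v \<le> 1"
      using x y k \<open>p k < x\<close> by (auto simp: u_def v_def d'_def)
    have "q y = (f v - f u) / (v - u)" unfolding q_def slope_interval[OF y(2)] u_def v_def ..
    then have "s k * (f v - f u) < - c * (v - u)"
      using y(4) uv(1) by (simp add: pos_divide_less_eq)
    moreover have "s k * (f v - f u) \<ge> - (V v - V u)" using V[of u v] uv by (auto simp: s_def)
    ultimately have "2 * c * (v - u) \<le> G k v - G k u"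
      unfolding G_def by (simp add: algebra_simps)
    with uv kn show "\<exists>u v. (u, v) \<in> K \<and> x \<in> {u..v} \<and> v - u < d" unfolding K_def by blast
  next
    fix F assume F: "finite F" "F \<subseteq> K" "pairwise (\<lambda>i j. disjnt {fst i..snd i} {fst j..snd j}) F"
    have "\<forall>i\<in>F. \<exists>k<n. p k \<le> fst i \<and> fst i < snd i \<and> snd i \<le> p (Suc k) \<and>
             2 * c * (snd i - fst i) \<le> G k (snd i) - G k (fst i)"
      using F(2) unfolding K_def by fastforce
    then obtain \<kappa> where \<kappa>: "\<And>i. i \<in> F \<Longrightarrow> \<kappa> i < n \<and> p (\<kappa> i) \<le> fst i \<and> fst i < snd i \<and> snd i \<le> p (Suc (\<kappa> i)) \<and>
             2 * c * (snd i - fst i) \<le> G (\<kappa> i) (snd i) - G (\<kappa> i) (fst i)"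
      by metis
    have "2 * c * (\<Sum>i\<in>F. snd i - fst i) \<le> (\<Sum>i\<in>F. G (\<kappa> i) (snd i) - G (\<kappa> i) (fst i))"
      unfolding sum_distrib_left using \<kappa> by (intro sum_mono) auto
    also have "\<dots> = (\<Sum>k<n. \<Sum>i\<in>{i\<in>F. \<kappa> i = k}. G (\<kappa> i) (snd i) - G (\<kappa> i) (fst i))"
      by (rule sum.group[symmetric]) (use F \<kappa> in auto)
    also have "\<dots> \<le> (\<Sum>k<n. G k (p (Suc k)) - G k (p k))"
    proof (rule sum_mono)
      fix k assume k: "k \<in> {..<n}"
      have "(\<Sum>i\<in>{i\<in>F. \<kappa> i = k}. G k (snd i) - G k (fst i)) \<le> G k (p (Suc k)) - G k (p k)"
      proof (rule sum_disjoint_increments_le[where l = fst and u = snd])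
        show "mono_on {p k..p (Suc k)} (G k)" using mono k by simp
        show "pairwise (\<lambda>i j. disjnt {fst i..snd i} {fst j..snd j}) {i \<in> F. \<kappa> i = k}"
          by (rule pairwise_subset[OF F(3)]) auto
      qed (use F(1) pI \<kappa> in auto)
      then show "(\<Sum>i\<in>{i\<in>F. \<kappa> i = k}. G (\<kappa> i) (snd i) - G (\<kappa> i) (fst i)) \<le> G k (p (Suc k)) - G k (p k)"
        by simp
    qed
    also have "\<dots> = (\<Sum>k<n. V (p (Suc k)) - V (p k)) - (\<Sum>k<n. \<bar>f (p (Suc k)) - f (p k)\<bar>)"
      unfolding sum_subtractf[symmetric] by (rule sum.cong) (auto simp: G_def s_def)
    also have "(\<Sum>k<n. V (p (Suc k)) - V (p k)) = V 1 - V 0"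
      using sum_lessThan_telescope[of "\<lambda>k. V (p k)" n] p by simp
    finally have "2 * c * (\<Sum>i\<in>F. snd i - fst i) \<le> 2 * c * e" using near V0 by linarith
    then show "(\<Sum>i\<in>F. snd i - fst i) \<le> e" using \<open>c > 0\<close> by simp
  qed (auto simp: K_def)
  then obtain T where T: "?S - p ` {..n} \<subseteq> T" "T \<in> lmeasurable" "measure lebesgue T \<le> e" by blast
  have fin: "negligible (p ` {..n})" by (rule negligible_finite) simp
  show "\<exists>T. ?S \<subseteq> T \<and> T \<in> lmeasurable \<and> measure lebesgue T \<le> e"
  proof (intro exI conjI)
    show "?S \<subseteq> T \<union> p ` {..n}" using T(1) by blast
    show "T \<union> p ` {..n} \<in> lmeasurable" using T(2) fin by (auto intro: negligible_imp_measurable)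
    show "measure lebesgue (T \<union> p ` {..n}) \<le> e"
      using measure_Un_null_set[of T lebesgue "p ` {..n}"] T(2,3) fin
      by (simp add: negligible_iff_null_sets fmeasurableD)
  qed
qed

text \<open>
  If the difference quotients are bounded near \<open>x\<close> but do not converge, two rationals \<open>r < s\<close>
  separate their lower and upper limits. Subtracting the linear function of slope \<open>(r + s)/2\<close>
  makes the quotients oscillate beyond \<open>\<plusminus>(s - r)/2\<close>, so \<open>negligible_oscillating_slopes\<close> covers
  these \<open>x\<close> by countably many null sets.
\<close>

lemma AC_differentiable_AE:
  assumes "f \<in> AC"
  shows "\<exists>N. negligible N \<and> (\<forall>x\<in>I - N. (f has_real_derivative D f x) (at x within I))"
proof -
  define q where "q = (\<lambda>x y. (f y - f x) / (y - x))"
  define E0 where "E0 = {x \<in> I. \<forall>M d. d > 0 \<longrightarrow> (\<exists>y\<in>I. y \<noteq> x \<and> \<bar>y - x\<bar> < d \<and> \<bar>q x y\<bar> > M)}"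
  define E where "E = (\<lambda>r s. {x \<in> I. \<forall>d>0. (\<exists>y\<in>I. y \<noteq> x \<and> \<bar>y - x\<bar> < d \<and> q x y > s) \<and>
                                 (\<exists>y\<in>I. y \<noteq> x \<and> \<bar>y - x\<bar> < d \<and> q x y < r)})"
  define Q where "Q = {(r::rat, s::rat). r < s}"
  define N where "N = E0 \<union> (\<Union>(r, s)\<in>Q. E (of_rat r) (of_rat s))"
  have E0: "negligible E0"
    using negligible_unbounded_slopes[OF assms] by (simp add: E0_def q_def)
  have E: "negligible (E r s)" if "r < s" for r s
  proof (rule negligible_subset)
    define g where "g = (\<lambda>x. 1 * f x + (- ((r + s) / 2)) * x)"
    have g: "g \<in> AC" unfolding g_def by (rule AC_lincomb[OF assms AC_ident])
    have slope: "(g y - g x) / (y - x) = q x y - (r + s) / 2" if "y \<noteq> x" for x y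
      using that by (simp add: g_def q_def field_simps)
    have gs: "(s - r) / 2 < (g y - g x) / (y - x) \<longleftrightarrow> s < q x y"
      "(g y - g x) / (y - x) < - ((s - r) / 2) \<longleftrightarrow> q x y < r" if "y \<noteq> x" for x y
      unfolding slope[OF that] by (auto simp: field_simps)
    show "negligible {x \<in> I. \<forall>d>0. (\<exists>y\<in>I. y \<noteq> x \<and> \<bar>y - x\<bar> < d \<and> (g y - g x) / (y - x) > (s - r) / 2) \<and>
                                 (\<exists>y\<in>I. y \<noteq> x \<and> \<bar>y - x\<bar> < d \<and> (g y - g x) / (y - x) < - ((s - r) / 2))}"
      (is "negligible ?T")
      using negligible_oscillating_slopes[OF g, of "(s - r) / 2"] that by simp
    show "E r s \<subseteq> ?T"
      unfolding E_def using gs by (auto 0 0) (metis atLeastAtMost_iff)+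
  qed
  have "negligible (\<Union>(r, s)\<in>Q. E (of_rat r) (of_rat s))"
    unfolding negligible_iff_null_sets
    by (rule null_sets_UN') (auto simp: negligible_iff_null_sets[symmetric] Q_def of_rat_less intro!: E)
  then have "negligible N" unfolding N_def by (rule negligible_Un[OF E0])
  moreover have "(f has_real_derivative D f x) (at x within I)" if x: "x \<in> I - N" for x
  proof -
    define F where "F = at x within I"
    have F: "F \<noteq> bot" using x by (auto simp: F_def trivial_limit_within islimpt_Icc)
    have evI: "eventually P F" if "d > 0" "\<And>y. y \<in> I \<Longrightarrow> y \<noteq> x \<Longrightarrow> \<bar>y - x\<bar> < d \<Longrightarrow> P y" for P d
      unfolding F_def eventually_at using that by (auto simp: dist_real_def)
    have "\<exists>M d. d > 0 \<and> (\<forall>y\<in>I. y \<noteq> x \<longrightarrow> \<bar>y - x\<bar> < d \<longrightarrow> \<bar>q x y\<bar> \<le> M)"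
      using x unfolding N_def E0_def by (auto simp: not_less) (metis atLeastAtMost_iff linorder_not_le)
    then obtain M d where "d > 0" and M: "\<And>y. y \<in> I \<Longrightarrow> y \<noteq> x \<Longrightarrow> \<bar>y - x\<bar> < d \<Longrightarrow> \<bar>q x y\<bar> \<le> M"
      by blast
    have up: "Limsup F (\<lambda>y. ereal (q x y)) \<le> ereal M"
      by (rule Limsup_bounded, rule evI[OF \<open>d > 0\<close>]) (use M in force)
    have lo: "Liminf F (\<lambda>y. ereal (q x y)) \<ge> ereal (- M)"
      by (rule Liminf_bounded, rule evI[OF \<open>d > 0\<close>]) (use M in force)
    have le: "Liminf F (\<lambda>y. ereal (q x y)) \<le> Limsup F (\<lambda>y. ereal (q x y))"
      by (rule Liminf_le_Limsup[OF F])
    have eq: "Liminf F (\<lambda>y. ereal (q x y)) = Limsup F (\<lambda>y. ereal (q x y))"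
    proof (rule ccontr)
      assume "\<not> ?thesis"
      then have "Liminf F (\<lambda>y. ereal (q x y)) < Limsup F (\<lambda>y. ereal (q x y))" using le by auto
      then obtain r where r: "Liminf F (\<lambda>y. ereal (q x y)) < ereal (real_of_rat r)"
        "ereal (real_of_rat r) < Limsup F (\<lambda>y. ereal (q x y))"
        using ereal_dense3 by blast
      then obtain s where s: "ereal (real_of_rat r) < ereal (real_of_rat s)"
        "ereal (real_of_rat s) < Limsup F (\<lambda>y. ereal (q x y))"
        using ereal_dense3 by blast
      have "(r, s) \<in> Q" using s(1) by (simp add: Q_def of_rat_less)
      then have "x \<notin> E (of_rat r) (of_rat s)" using x by (auto simp: N_def)
      then have "\<exists>d>0. (\<forall>y\<in>I. y \<noteq> x \<longrightarrow> \<bar>y - x\<bar> < d \<longrightarrow> q x y \<le> of_rat s) \<or>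
            (\<forall>y\<in>I. y \<noteq> x \<longrightarrow> \<bar>y - x\<bar> < d \<longrightarrow> of_rat r \<le> q x y)"
        using x unfolding E_def by (simp add: not_less) (metis linorder_not_le)
      then obtain d where "d > 0" and
        *: "(\<forall>y\<in>I. y \<noteq> x \<longrightarrow> \<bar>y - x\<bar> < d \<longrightarrow> q x y \<le> of_rat s) \<or>
            (\<forall>y\<in>I. y \<noteq> x \<longrightarrow> \<bar>y - x\<bar> < d \<longrightarrow> of_rat r \<le> q x y)"
        by blast
      show False
      proof (rule disjE[OF *])
        assume "\<forall>y\<in>I. y \<noteq> x \<longrightarrow> \<bar>y - x\<bar> < d \<longrightarrow> q x y \<le> of_rat s"
        then have "Limsup F (\<lambda>y. ereal (q x y)) \<le> ereal (of_rat s)"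
          by (intro Limsup_bounded evI[OF \<open>d > 0\<close>]) auto
        with s(2) show False by simp
      next
        assume "\<forall>y\<in>I. y \<noteq> x \<longrightarrow> \<bar>y - x\<bar> < d \<longrightarrow> of_rat r \<le> q x y"
        then have "ereal (of_rat r) \<le> Liminf F (\<lambda>y. ereal (q x y))"
          by (intro Liminf_bounded evI[OF \<open>d > 0\<close>]) auto
        with r(1) show False by simp
      qed
    qed
    obtain l where l: "Limsup F (\<lambda>y. ereal (q x y)) = ereal l"
      using up lo unfolding eq by (cases "Limsup F (\<lambda>y. ereal (q x y))") auto
    have "((\<lambda>y. ereal (q x y)) \<longlongrightarrow> ereal l) F"
      unfolding tendsto_iff_Liminf_eq_Limsup[OF F] using eq l by simp
    then have "(f has_real_derivative l) (at x within I)"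
      unfolding has_field_derivative_iff F_def q_def by simp
    then show ?thesis
      using x vector_derivative_within_closed_interval[of 0 1 x f l]
      unfolding D_def has_real_derivative_iff_has_vector_derivative by auto
  qed
  ultimately show ?thesis by blast
qed

section \<open>The fundamental theorem of calculus\<close>

text \<open>
  Tagged divisions are finite sets rather than sequences, so absolute continuity is restated for
  families over an arbitrary finite index set.
\<close>

lemma AC_finite_family:
  assumes "f \<in> AC" "e > 0"
  shows "\<exists>\<delta>>0. \<forall>P l u. finite P \<and> (\<forall>i\<in>P. 0 \<le> l i \<and> l i \<le> u i \<and> u i \<le> 1) \<and>
     disjoint_family_on (\<lambda>i. {l i<..<u i}) P \<and> (\<Sum>i\<in>P. u i - l i) < \<delta> \<longrightarrow>
     (\<Sum>i\<in>P. \<bar>f (u i) - f (l i)\<bar>) < e"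
proof -
  obtain \<delta> where d: "\<delta> > 0" "\<And>(n::nat) x y. (\<forall>k<n. 0 \<le> x k \<and> x k \<le> y k \<and> y k \<le> 1) \<and>
     disjoint_family_on (\<lambda>k. {x k<..<y k}) {..<n} \<and> (\<Sum>k<n. y k - x k) < \<delta> \<Longrightarrow>
     (\<Sum>k<n. \<bar>f (y k) - f (x k)\<bar>) < e"
    using assms(1)[unfolded AC_def mem_Collect_eq, rule_format, OF assms(2)] by blast
  show ?thesis
  proof (intro exI[of _ \<delta>] conjI allI impI; (elim conjE)?)
    fix P :: "'a set" and l u
    assume *: "finite P" "\<forall>i\<in>P. 0 \<le> l i \<and> l i \<le> u i \<and> u i \<le> 1"
      "disjoint_family_on (\<lambda>i. {l i<..<u i}) P" "(\<Sum>i\<in>P. u i - l i) < \<delta>"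
    obtain h where h: "bij_betw h {..<card P} P"
      using ex_bij_betw_nat_finite[OF *(1)] by (auto simp: atLeast0LessThan)
    have eq: "(\<Sum>i\<in>P. G i) = (\<Sum>k<card P. G (h k))" for G :: "'a \<Rightarrow> real"
      using sum.reindex_bij_betw[OF h, of G] by simp
    have hP: "k < card P \<Longrightarrow> h k \<in> P" for k using h by (auto simp: bij_betw_def)
    have inj: "inj_on h {..<card P}" using h by (simp add: bij_betw_def)
    show "(\<Sum>i\<in>P. \<bar>f (u i) - f (l i)\<bar>) < e"
      unfolding eq
    proof (rule d(2), intro conjI allI impI)
      show "disjoint_family_on (\<lambda>k. {l (h k)<..<u (h k)}) {..<card P}"
        using *(3) hP inj unfolding disjoint_family_on_def inj_on_def by (metis lessThan_iff)
    qed (use * hP eq in auto)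
  qed (fact d(1))
qed

text \<open>
  The derivative may be altered on the null set, so put it to \<open>0\<close> there. The gauge then has two
  parts: at a tag outside \<open>N\<close> it forces the linear approximation, as in the classical theorem; at a
  tag in \<open>N\<close> it keeps the cell inside an open set \<open>T \<supseteq> N\<close> of measure less than \<open>\<delta>\<close>, where absolute
  continuity controls the sum of the increments of \<open>f\<close>.
\<close>

theorem AC_fundamental_theorem_of_calculus:
  assumes f: "f \<in> AC" and ab: "0 \<le> a" "a \<le> b" "b \<le> 1" and N: "negligible N"
    and f': "\<And>x. x \<in> {a..b} - N \<Longrightarrow> (f has_real_derivative f' x) (at x within {a..b})"
  shows "(f' has_integral (f b - f a)) {a..b}"
proof -
  define g where "g = (\<lambda>x. if x \<in> N then 0 else f' x)"
  have "(g has_integral (f b - f a)) {a..b}"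
    unfolding has_integral_real
  proof (intro allI impI)
    fix e :: real assume "e > 0"
    define \<eta> where "\<eta> = e / 2 / (b - a + 1)"
    have ba: "b - a + 1 > 0" using ab by simp
    then have "\<eta> > 0" using \<open>e > 0\<close> ab by (simp add: \<eta>_def)
    have "e / 2 > 0" using \<open>e > 0\<close> by simp
    obtain \<delta> where \<delta>: "\<delta> > 0" "\<forall>(P :: (real \<times> real set) set) l u. finite P \<and> (\<forall>i\<in>P. 0 \<le> l i \<and> l i \<le> u i \<and> u i \<le> 1) \<and>
       disjoint_family_on (\<lambda>i. {l i<..<u i}) P \<and> (\<Sum>i\<in>P. u i - l i) < \<delta> \<longrightarrow>
       (\<Sum>i\<in>P. \<bar>f (u i) - f (l i)\<bar>) < e / 2"
      using AC_finite_family[OF f \<open>e / 2 > 0\<close>] by blast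
    obtain T where T: "open T" "N \<subseteq> T" "T - N \<in> lmeasurable" "measure lebesgue (T - N) < \<delta>"
    proof -
      obtain T where T: "open T" "N \<subseteq> T" "T - N \<in> lmeasurable" "emeasure lebesgue (T - N) < ennreal \<delta>"
        using sets_lebesgue_outer_open[OF negligible_imp_sets[OF N] \<delta>(1)] .
      show thesis
        using T(4) \<delta>(1) unfolding emeasure_eq_measure2[OF T(3)]
        by (intro that[OF T(1-3)]) (simp add: ennreal_less_iff)
    qed
    have Tm: "T \<in> lmeasurable" "measure lebesgue T < \<delta>"
    proof -
      have "T = (T - N) \<union> N" using T(2) by blast
      then show "T \<in> lmeasurable" using fmeasurable.Un[OF T(3) negligible_imp_measurable[OF N]] by metis
      have "measure lebesgue ((T - N) \<union> N) = measure lebesgue (T - N)"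
        by (rule measure_Un_null_set) (use T(3) N in \<open>auto simp: negligible_iff_null_sets\<close>)
      then show "measure lebesgue T < \<delta>" using T(4) \<open>T = (T - N) \<union> N\<close> by metis
    qed
    have "\<forall>x. \<exists>d>0. (x \<in> N \<longrightarrow> ball x d \<subseteq> T) \<and> (x \<in> {a..b} - N \<longrightarrow>
         (\<forall>y\<in>{a..b}. \<bar>y - x\<bar> < d \<longrightarrow> \<bar>f y - f x - (y - x) * g x\<bar> \<le> \<eta> * \<bar>y - x\<bar>))"
    proof
      fix x
      consider "x \<in> N" | "x \<in> {a..b} - N" | "x \<notin> N" "x \<notin> {a..b}" by blast
      then show "\<exists>d>0. (x \<in> N \<longrightarrow> ball x d \<subseteq> T) \<and> (x \<in> {a..b} - N \<longrightarrow>
         (\<forall>y\<in>{a..b}. \<bar>y - x\<bar> < d \<longrightarrow> \<bar>f y - f x - (y - x) * g x\<bar> \<le> \<eta> * \<bar>y - x\<bar>))"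
      proof cases
        case 1 then show ?thesis using T(1,2) by (metis DiffD2 openE subsetD)
      next
        case 2
        then have "(f has_vector_derivative g x) (at x within {a..b})"
          using f'[OF 2] by (simp add: g_def has_real_derivative_iff_has_vector_derivative)
        then show ?thesis
          using 2 \<open>\<eta> > 0\<close> unfolding has_vector_derivative_def has_derivative_within_alt by auto
      next
        case 3 then show ?thesis by (intro exI[of _ 1]) auto
      qed
    qed
    then obtain d where d: "\<And>x. 0 < d x" "\<And>x. x \<in> N \<Longrightarrow> ball x (d x) \<subseteq> T"
      "\<And>x y. x \<in> {a..b} - N \<Longrightarrow> y \<in> {a..b} \<Longrightarrow> \<bar>y - x\<bar> < d x \<Longrightarrow>
          \<bar>f y - f x - (y - x) * g x\<bar> \<le> \<eta> * \<bar>y - x\<bar>"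
      by metis
    show "\<exists>\<gamma>. gauge \<gamma> \<and> (\<forall>\<D>. \<D> tagged_division_of {a..b} \<and> \<gamma> fine \<D> \<longrightarrow>
        norm ((\<Sum>(x,k)\<in>\<D>. measure lborel k *\<^sub>R g x) - (f b - f a)) < e)"
    proof (intro exI conjI allI impI)
      show "gauge (\<lambda>x. ball x (d x))" using d(1) gauge_ball_dependent by blast
    next
      fix p assume "p tagged_division_of {a..b} \<and> (\<lambda>x. ball x (d x)) fine p"
      then have p: "p tagged_division_of {a..b}" and fine: "(\<lambda>x. ball x (d x)) fine p" by auto
      have fin: "finite p" using p by blast
      define l u where "l = (\<lambda>i::real \<times> real set. Inf (snd i))" and "u = (\<lambda>i::real \<times> real set. Sup (snd i))"
      have cell: "a \<le> l i" "l i \<le> fst i" "fst i \<le> u i" "u i \<le> b" "snd i = {l i..u i}"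
        "{l i..u i} \<subseteq> ball (fst i) (d (fst i))" if ip: "i \<in> p" for i
      proof -
        obtain x K where i: "i = (x, K)" by fastforce
        have xK: "x \<in> K" "K \<subseteq> {a..b}" using tagged_division_ofD(2,3)[OF p] ip i by auto
        obtain c c' where K: "K = cbox c c'" using tagged_division_ofD(4)[OF p] ip i by blast
        then have "c \<le> c'" using xK by auto
        then have lu: "l i = c" "u i = c'" using K i by (auto simp: l_def u_def)
        show "a \<le> l i" "l i \<le> fst i" "fst i \<le> u i" "u i \<le> b" "snd i = {l i..u i}"
          using xK K \<open>c \<le> c'\<close> unfolding lu by (auto simp: i)
        have "K \<subseteq> ball x (d x)" using fineD[OF fine] ip i by blast
        then show "{l i..u i} \<subseteq> ball (fst i) (d (fst i))"
          unfolding lu by (simp add: i K)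
      qed
      have disj: "{l i<..<u i} \<inter> {l j<..<u j} = {}" if "i \<in> p" "j \<in> p" "i \<noteq> j" for i j
      proof -
        have "interior (snd i) \<inter> interior (snd j) = {}"
          using p that by (metis prod.collapse tagged_division_ofD(5))
        then show ?thesis using cell(5) that by (metis interior_atLeastAtMost_real)
      qed
      have tele: "b - a = (\<Sum>i\<in>p. u i - l i)" "f b - f a = (\<Sum>i\<in>p. f (u i) - f (l i))"
        using additive_tagged_division_1[OF ab(2) p, of "\<lambda>x. x"] additive_tagged_division_1[OF ab(2) p, of f]
        by (auto simp: case_prod_beta l_def u_def)
      define p1 where "p1 = {i \<in> p. fst i \<in> N}"
      define p2 where "p2 = {i \<in> p. fst i \<notin> N}"
      have pp: "p = p1 \<union> p2" "p1 \<inter> p2 = {}" "finite p1" "finite p2" "p1 \<subseteq> p" "p2 \<subseteq> p"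
        using fin by (auto simp: p1_def p2_def)
      define G where "G = (\<lambda>i. measure lborel (snd i) * g (fst i) - (f (u i) - f (l i)))"
      have len: "measure lborel (snd i) = u i - l i" if "i \<in> p" for i
        using cell(2,3)[OF that] unfolding cell(5)[OF that] by simp
      have "(\<Sum>i\<in>p1. u i - l i) < \<delta>"
      proof -
        have "(\<Sum>i\<in>p1. u i - l i) = (\<Sum>i\<in>p1. measure lebesgue {l i<..<u i})"
        proof (rule sum.cong[OF refl])
          fix i assume "i \<in> p1"
          then have "i \<in> p" using pp(5) by blast
          then have "l i \<le> u i" using cell(2,3)[of i] by linarith
          then show "u i - l i = measure lebesgue {l i<..<u i}" by simp
        qed
        also have "\<dots> = measure lebesgue (\<Union>i\<in>p1. {l i<..<u i})"
        proof (rule measure_finite_Union[symmetric])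
          show "disjoint_family_on (\<lambda>i. {l i<..<u i}) p1"
            unfolding disjoint_family_on_def using disj pp(5) by blast
          show "emeasure lebesgue {l i<..<u i} \<noteq> \<infinity>" for i
            using fmeasurableD2[OF lmeasurable_box[of "l i" "u i"]] by simp
        qed (use pp(3) in auto)
        also have "\<dots> \<le> measure lebesgue T"
        proof (rule measure_mono_fmeasurable)
          show "(\<Union>i\<in>p1. {l i<..<u i}) \<subseteq> T"
          proof
            fix z assume "z \<in> (\<Union>i\<in>p1. {l i<..<u i})"
            then obtain i where i: "i \<in> p" "fst i \<in> N" "z \<in> {l i..u i}" by (auto simp: p1_def)
            then show "z \<in> T" using cell(6)[OF i(1)] d(2)[OF i(2)] by blast
          qed
          show "(\<Union>i\<in>p1. {l i<..<u i}) \<in> sets lebesgue"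
            by (intro sets.finite_UN pp(3)) auto
        qed (use Tm in auto)
        finally show ?thesis using Tm by simp
      qed
      then have "(\<Sum>i\<in>p1. \<bar>f (u i) - f (l i)\<bar>) < e / 2"
      proof (intro \<delta>(2)[rule_format] conjI ballI)
        show "disjoint_family_on (\<lambda>i. {l i<..<u i}) p1"
          unfolding disjoint_family_on_def using disj pp(5) by blast
        fix i assume "i \<in> p1"
        then have "i \<in> p" using pp(5) by blast
        then show "0 \<le> l i" "l i \<le> u i" "u i \<le> 1"
          using cell(1-4)[of i] ab by linarith+
      qed (use pp(3) in auto)
      moreover have "\<bar>\<Sum>i\<in>p1. G i\<bar> \<le> (\<Sum>i\<in>p1. \<bar>f (u i) - f (l i)\<bar>)"
      proof (rule order_trans[OF sum_abs sum_mono])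
        fix i assume "i \<in> p1"
        then have "g (fst i) = 0" by (simp add: p1_def g_def)
        then show "\<bar>G i\<bar> \<le> \<bar>f (u i) - f (l i)\<bar>" by (simp add: G_def)
      qed
      moreover have "\<bar>\<Sum>i\<in>p2. G i\<bar> \<le> (\<Sum>i\<in>p2. \<eta> * (u i - l i))"
      proof (rule order_trans[OF sum_abs sum_mono])
        fix i assume i2: "i \<in> p2"
        then have i: "i \<in> p" "fst i \<in> {a..b} - N" using cell[of i] by (auto simp: p2_def)
        have near: "\<bar>f y - f (fst i) - (y - fst i) * g (fst i)\<bar> \<le> \<eta> * \<bar>y - fst i\<bar>" if "y \<in> {l i..u i}" for y
        proof (rule d(3)[OF i(2)])
          show "y \<in> {a..b}" using that cell[OF i(1)] by auto
          show "\<bar>y - fst i\<bar> < d (fst i)" using that cell(6)[OF i(1)] by (auto simp: dist_real_def)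
        qed
        have "G i = (f (l i) - f (fst i) - (l i - fst i) * g (fst i)) - (f (u i) - f (fst i) - (u i - fst i) * g (fst i))"
          by (simp add: G_def len[OF i(1)] algebra_simps)
        then have "\<bar>G i\<bar> \<le> \<eta> * \<bar>l i - fst i\<bar> + \<eta> * \<bar>u i - fst i\<bar>"
          using near[of "l i"] near[of "u i"] cell[OF i(1)] by auto
        also have "\<dots> = \<eta> * (u i - l i)" using cell[OF i(1)] by (simp add: algebra_simps)
        finally show "\<bar>G i\<bar> \<le> \<eta> * (u i - l i)" .
      qed
      moreover have "(\<Sum>i\<in>p2. \<eta> * (u i - l i)) \<le> (\<Sum>i\<in>p. \<eta> * (u i - l i))"
      proof (rule sum_mono2[OF fin pp(6)])
        fix i assume "i \<in> p - p2"
        then have "l i \<le> u i" using cell(2,3)[of i] by auto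
        then show "0 \<le> \<eta> * (u i - l i)" using \<open>\<eta> > 0\<close> by simp
      qed
      moreover have "(\<Sum>i\<in>p. \<eta> * (u i - l i)) < e / 2"
      proof -
        have "(\<Sum>i\<in>p. \<eta> * (u i - l i)) = \<eta> * (b - a)" unfolding tele by (simp add: sum_distrib_left)
        also have "\<dots> < \<eta> * (b - a + 1)" using \<open>\<eta> > 0\<close> by simp
        also have "\<dots> = e / 2" using less_imp_neq[OF ba] unfolding \<eta>_def by (metis nonzero_divide_eq_eq)
        finally show ?thesis .
      qed
      moreover have "(\<Sum>(x,k)\<in>p. measure lborel k *\<^sub>R g x) - (f b - f a) = (\<Sum>i\<in>p1. G i) + (\<Sum>i\<in>p2. G i)"
        unfolding tele(2) sum.union_disjoint[OF pp(3,4,2), symmetric] pp(1)[symmetric]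
        by (simp add: G_def sum_subtractf case_prod_beta)
      ultimately show "norm ((\<Sum>(x,k)\<in>p. measure lborel k *\<^sub>R g x) - (f b - f a)) < e"
        unfolding real_norm_def by linarith
    qed
  qed
  then show ?thesis
    by (rule has_integral_spike[OF N, rotated]) (auto simp: g_def)
qed

section \<open>Solutions of the equation\<close>

lemma has_derivative_imp_D:
  "t \<in> I \<Longrightarrow> (u has_real_derivative d) (at t within I) \<Longrightarrow> D u t = d"
  unfolding D_def has_real_derivative_iff_has_vector_derivative
  by (rule vector_derivative_within_closed_interval) auto

lemma W21_has_derivative:
  assumes "u \<in> W21" "t \<in> I"
  shows "(u has_real_derivative D u t) (at t within I)"
  using assms unfolding W21_def D_def differentiable_on_def has_real_derivative_iff_has_vector_derivative
  by (auto simp: vector_derivative_works[symmetric])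

lemma AC_cong:
  assumes "f \<in> AC" "\<And>t. t \<in> I \<Longrightarrow> g t = f t"
  shows "g \<in> AC"
  by (rule AC_dominated[OF assms(1,1), of _ 1 0]) (use assms(2) in auto)

lemma AE_lebesgue_on_iff_negligible:
  "(AE t in lebesgue_on I. P t) \<longleftrightarrow> (\<exists>N. negligible N \<and> (\<forall>t\<in>I - N. P t))"
proof -
  have "(AE t in lebesgue_on I. P t) \<longleftrightarrow> (AE t in lebesgue. t \<in> I \<longrightarrow> P t)"
    by (rule AE_restrict_space_iff) auto
  also have "\<dots> \<longleftrightarrow> (\<exists>N. negligible N \<and> (\<forall>t\<in>I - N. P t))"
    unfolding eventually_ae_filter negligible_iff_null_sets Bex_def
    by (intro ex_cong1) (auto simp: subset_iff)
  finally show ?thesis .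
qed

text \<open>
  A solution together with its derivative \<open>v\<close>. Both derivatives are asserted to exist where they are
  used, and the exceptional null set is explicit. Unlike \<open>L\<close>, whose value at a point where the
  second derivative fails to exist is arbitrary, this predicate is visibly linear.
\<close>

definition solution :: "(real \<Rightarrow> real) \<Rightarrow> real \<Rightarrow> (real \<Rightarrow> real) \<Rightarrow> (real \<Rightarrow> real) \<Rightarrow> (real \<Rightarrow> real) \<Rightarrow> bool" where
  "solution a lam \<sigma> u v \<longleftrightarrow>
     (\<forall>t\<in>I. (u has_real_derivative v t) (at t within I)) \<and> v \<in> AC \<and>
     (\<exists>N. negligible N \<and> (\<forall>t\<in>I - N. (v has_real_derivative \<sigma> t - (a t + lam) * u t) (at t within I)))"

text \<open>
  This direction depends on Lebesgue's theorem: \<open>L a lam u t = \<sigma> t\<close> yields information about a derivative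
  of \<open>D u\<close> only at points where \<open>D u\<close> is differentiable.
\<close>

lemma solution_D:
  assumes "u \<in> W21" "AE t in lebesgue_on I. L a lam u t = \<sigma> t"
  shows "solution a lam \<sigma> u (D u)"
proof -
  have AC: "D u \<in> AC" using assms(1) by (simp add: W21_def)
  obtain N1 where N1: "negligible N1" "\<forall>t\<in>I - N1. L a lam u t = \<sigma> t"
    using assms(2) unfolding AE_lebesgue_on_iff_negligible by blast
  obtain N2 where N2: "negligible N2" "\<forall>t\<in>I - N2. (D u has_real_derivative D (D u) t) (at t within I)"
    using AC_differentiable_AE[OF AC] by blast
  have "(D u has_real_derivative \<sigma> t - (a t + lam) * u t) (at t within I)" if t: "t \<in> I - (N1 \<union> N2)" for t
  proof -
    have "D (D u) t = \<sigma> t - (a t + lam) * u t"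
      using t N1(2) by (auto simp: L_def algebra_simps)
    then show ?thesis using t N2(2) by (metis Diff_iff UnCI)
  qed
  then show ?thesis
    unfolding solution_def using W21_has_derivative[OF assms(1)] AC negligible_Un[OF N1(1) N2(1)] by blast
qed

lemma
  assumes "solution a lam \<sigma> u v"
  shows solution_W21: "u \<in> W21"
    and solution_AE: "AE t in lebesgue_on I. L a lam u t = \<sigma> t"
proof -
  have d: "(u has_real_derivative v t) (at t within I)" if "t \<in> I" for t
    using assms that by (simp add: solution_def)
  have eq: "D u t = v t" if "t \<in> I" for t using has_derivative_imp_D[OF that d[OF that]] .
  have "v \<in> AC" using assms by (simp add: solution_def)
  then have "D u \<in> AC" using eq by (rule AC_cong)
  moreover have "u differentiable_on I"
    unfolding differentiable_on_def using d by (meson has_field_derivative_def differentiableI)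
  ultimately show "u \<in> W21" by (simp add: W21_def differentiable_imp_continuous_on)
  obtain N where N: "negligible N" "\<forall>t\<in>I - N. (v has_real_derivative \<sigma> t - (a t + lam) * u t) (at t within I)"
    using assms unfolding solution_def by blast
  have "L a lam u t = \<sigma> t" if t: "t \<in> I - N" for t
  proof -
    have "(D u has_real_derivative \<sigma> t - (a t + lam) * u t) (at t within I)"
      using has_field_derivative_transform_within[OF N(2)[rule_format, OF t], of 1 "D u"] eq t by auto
    then have "D (D u) t = \<sigma> t - (a t + lam) * u t" using t by (intro has_derivative_imp_D) auto
    then show ?thesis by (simp add: L_def)
  qed
  then show "AE t in lebesgue_on I. L a lam u t = \<sigma> t"
    unfolding AE_lebesgue_on_iff_negligible using N(1) by blast
qed

lemma solution_lincomb:
  assumes "solution a lam \<sigma>\<^sub>1 u\<^sub>1 v\<^sub>1" "solution a lam \<sigma>\<^sub>2 u\<^sub>2 v\<^sub>2"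
  shows "solution a lam (\<lambda>t. A * \<sigma>\<^sub>1 t + B * \<sigma>\<^sub>2 t) (\<lambda>t. A * u\<^sub>1 t + B * u\<^sub>2 t) (\<lambda>t. A * v\<^sub>1 t + B * v\<^sub>2 t)"
proof -
  obtain N1 N2 where N: "negligible N1" "negligible N2"
    "\<forall>t\<in>I - N1. (v\<^sub>1 has_real_derivative \<sigma>\<^sub>1 t - (a t + lam) * u\<^sub>1 t) (at t within I)"
    "\<forall>t\<in>I - N2. (v\<^sub>2 has_real_derivative \<sigma>\<^sub>2 t - (a t + lam) * u\<^sub>2 t) (at t within I)"
    using assms unfolding solution_def by blast
  have "((\<lambda>t. A * v\<^sub>1 t + B * v\<^sub>2 t) has_real_derivative
      A * \<sigma>\<^sub>1 t + B * \<sigma>\<^sub>2 t - (a t + lam) * (A * u\<^sub>1 t + B * u\<^sub>2 t)) (at t within I)"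
    if "t \<in> I - (N1 \<union> N2)" for t
    using N(3,4) that by (auto intro!: derivative_eq_intros simp: algebra_simps)
  moreover have "((\<lambda>t. A * u\<^sub>1 t + B * u\<^sub>2 t) has_real_derivative A * v\<^sub>1 t + B * v\<^sub>2 t) (at t within I)"
    if "t \<in> I" for t
    using assms that unfolding solution_def by (auto intro!: derivative_eq_intros)
  ultimately show ?thesis
    using assms AC_lincomb negligible_Un[OF N(1,2)] unfolding solution_def by blast
qed

lemma AC_if_continuous_derivative:
  assumes d: "\<And>t. t \<in> I \<Longrightarrow> (f has_real_derivative f' t) (at t within I)" and c: "continuous_on I f'"
  shows "f \<in> AC"
proof -
  obtain B where B: "\<And>t. t \<in> I \<Longrightarrow> \<bar>f' t\<bar> \<le> B"
    using compact_imp_bounded[OF compact_continuous_image[OF c compact_Icc]]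
    unfolding bounded_iff by (metis imageI real_norm_def)
  show ?thesis
  proof (rule AC_dominated[OF AC_ident AC_ident, of _ B 0])
    fix x y :: real assume "0 \<le> x" "x \<le> y" "y \<le> 1"
    then have "norm (f y - f x) \<le> B * norm (y - x)"
      using B by (intro field_differentiable_bound[OF convex_real_interval(5)[of 0 1] d]) auto
    then show "\<bar>f y - f x\<bar> \<le> B * \<bar>y - x\<bar> + 0 * \<bar>y - x\<bar>" by simp
  qed
qed

lemma solution_AC:
  assumes "solution a lam \<sigma> u v" shows "u \<in> AC" "v \<in> AC"
proof -
  show "v \<in> AC" using assms by (simp add: solution_def)
  then show "u \<in> AC"
    using assms AC_continuous_on by (intro AC_if_continuous_derivative[of u v]) (auto simp: solution_def)
qed

lemma Wronskian_constant:
  assumes 1: "solution a lam (\<lambda>_. 0) u\<^sub>1 v\<^sub>1" and 2: "solution a lam (\<lambda>_. 0) u\<^sub>2 v\<^sub>2" and t: "t \<in> I"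
  shows "u\<^sub>1 t * v\<^sub>2 t - v\<^sub>1 t * u\<^sub>2 t = u\<^sub>1 0 * v\<^sub>2 0 - v\<^sub>1 0 * u\<^sub>2 0"
proof -
  define w where "w = (\<lambda>t. 1 * (u\<^sub>1 t * v\<^sub>2 t) + (- 1) * (v\<^sub>1 t * u\<^sub>2 t))"
  have "w \<in> AC" unfolding w_def by (intro AC_lincomb AC_mult solution_AC[OF 1] solution_AC[OF 2])
  obtain N1 N2 where N: "negligible N1" "negligible N2"
    "\<forall>t\<in>I - N1. (v\<^sub>1 has_real_derivative 0 - (a t + lam) * u\<^sub>1 t) (at t within I)"
    "\<forall>t\<in>I - N2. (v\<^sub>2 has_real_derivative 0 - (a t + lam) * u\<^sub>2 t) (at t within I)"
    using 1 2 unfolding solution_def by blast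
  have "((\<lambda>_. 0) has_integral (w t - w 0)) {0..t}"
  proof (rule AC_fundamental_theorem_of_calculus[OF \<open>w \<in> AC\<close>])
    show "negligible (N1 \<union> N2)" by (rule negligible_Un[OF N(1,2)])
    fix x assume x: "x \<in> {0..t} - (N1 \<union> N2)"
    then have xI: "x \<in> I" using t by auto
    have d: "(v\<^sub>1 has_real_derivative - ((a x + lam) * u\<^sub>1 x)) (at x within I)"
      "(v\<^sub>2 has_real_derivative - ((a x + lam) * u\<^sub>2 x)) (at x within I)"
      "(u\<^sub>1 has_real_derivative v\<^sub>1 x) (at x within I)"
      "(u\<^sub>2 has_real_derivative v\<^sub>2 x) (at x within I)"
      using N(3,4) x xI 1 2 by (auto simp: solution_def)
    have "(w has_real_derivative 0) (at x within I)"
      unfolding w_def by (rule derivative_eq_intros d refl)+ (simp add: algebra_simps)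
    then show "(w has_real_derivative 0) (at x within {0..t})"
      by (rule has_field_derivative_subset) (use t in auto)
  qed (use t in auto)
  then have "w t - w 0 = 0" using has_integral_0 has_integral_unique by blast
  then show ?thesis by (simp add: w_def)
qed

text \<open>
  Gronwall's argument with an integrable coefficient. On an interval over which \<open>1 + \<bar>a + lam\<bar>\<close> has
  integral at most \<open>1/2\<close>, the maximum \<open>M\<close> of \<open>\<bar>u\<bar> + \<bar>v\<bar>\<close> satisfies \<open>M \<le> M/2\<close> if \<open>u\<close> and \<open>v\<close> vanish at the left end.
  Uniform continuity of the indefinite integral lets finitely many such intervals cover \<open>I\<close>.
\<close>

lemma solution_zero_initial_values:
  assumes a: "a \<in> L1" and s: "solution a lam (\<lambda>_. 0) u v" and init: "u 0 = 0" "v 0 = 0" and t: "t \<in> I"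
  shows "u t = 0"
proof -
  define k where "k = (\<lambda>t. 1 + \<bar>a t + lam\<bar>)"
  have ai: "integrable (lebesgue_on I) a" using a by (simp add: L1_def)
  have ci: "integrable (lebesgue_on I) (\<lambda>_. c::real)" for c by (rule continuous_imp_integrable_real) simp
  have "integrable (lebesgue_on I) k"
    unfolding k_def by (intro Bochner_Integration.integrable_add integrable_abs ai ci)
  then have kI: "k integrable_on I" by (intro integrable_on_lebesgue_on) auto
  have kint: "k integrable_on {x..y}" if "0 \<le> x" "y \<le> 1" for x y
    by (rule integrable_subinterval_real[OF kI]) (use that in auto)
  obtain N where N: "negligible N"
    "\<forall>t\<in>I - N. (v has_real_derivative - ((a t + lam) * u t)) (at t within I)"
    using s unfolding solution_def by auto
  have u: "continuous_on I u" and v: "continuous_on I v"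
    using solution_AC[OF s] AC_continuous_on by auto
  have "uniformly_continuous_on I (\<lambda>x. integral {0..x} k)"
    by (intro compact_uniformly_continuous indefinite_integral_continuous_1[OF kI]) auto
  then obtain \<delta> where \<delta>: "\<delta> > 0" "\<And>x y. x \<in> I \<Longrightarrow> y \<in> I \<Longrightarrow> \<bar>y - x\<bar> < \<delta> \<Longrightarrow>
      \<bar>integral {0..y} k - integral {0..x} k\<bar> < 1 / 2"
    unfolding uniformly_continuous_on_def dist_real_def
    by (metis half_gt_zero_iff zero_less_one)
  have step: "\<forall>z\<in>{x..y}. u z = 0 \<and> v z = 0"
    if xy: "0 \<le> x" "x \<le> y" "y \<le> 1" "y - x < \<delta>" and x0: "u x = 0" "v x = 0" for x y
  proof -
    have "continuous_on {x..y} (\<lambda>z. \<bar>u z\<bar> + \<bar>v z\<bar>)"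
      using xy by (intro continuous_intros continuous_on_subset[OF u] continuous_on_subset[OF v]) auto
    then have "\<exists>z\<in>{x..y}. \<forall>w\<in>{x..y}. \<bar>u w\<bar> + \<bar>v w\<bar> \<le> \<bar>u z\<bar> + \<bar>v z\<bar>"
      using xy by (intro continuous_attains_sup) auto
    then obtain z where z: "z \<in> {x..y}" "\<And>w. w \<in> {x..y} \<Longrightarrow> \<bar>u w\<bar> + \<bar>v w\<bar> \<le> \<bar>u z\<bar> + \<bar>v z\<bar>" by blast
    define M where "M = \<bar>u z\<bar> + \<bar>v z\<bar>"
    have sub: "{x..z} \<subseteq> I" using z xy by auto
    have Iu: "(v has_integral (u z - u x)) {x..z}"
    proof (rule AC_fundamental_theorem_of_calculus[OF solution_AC(1)[OF s] _ _ _ negligible_empty])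
      fix w assume "w \<in> {x..z} - {}"
      then have "(u has_real_derivative v w) (at w within I)" using s sub by (auto simp: solution_def)
      then show "(u has_real_derivative v w) (at w within {x..z})"
        using sub by (rule has_field_derivative_subset)
    qed (use z xy in auto)
    have Iv: "((\<lambda>t. - ((a t + lam) * u t)) has_integral (v z - v x)) {x..z}"
    proof (rule AC_fundamental_theorem_of_calculus[OF solution_AC(2)[OF s] _ _ _ N(1)])
      fix w assume "w \<in> {x..z} - N"
      then have "(v has_real_derivative - ((a w + lam) * u w)) (at w within I)" using N(2) sub by auto
      then show "(v has_real_derivative - ((a w + lam) * u w)) (at w within {x..z})"
        using sub by (rule has_field_derivative_subset)
    qed (use z xy in auto)
    have ks: "k integrable_on {x..z}" using kint z xy by auto
    have "\<bar>u z\<bar> \<le> integral {x..z} (\<lambda>t. M)"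
    proof -
      have "norm (v t) \<le> M" if "t \<in> {x..z}" for t
        using z(2)[of t] z(1) that by (auto simp: M_def)
      then have "norm (integral {x..z} v) \<le> integral {x..z} (\<lambda>t. M)"
        using Iu by (intro integral_norm_bound_integral) (auto simp: has_integral_iff)
      then show ?thesis using Iu x0 by (simp add: has_integral_iff)
    qed
    moreover have "\<bar>v z\<bar> \<le> integral {x..z} (\<lambda>t. M * (k t - 1))"
    proof -
      have "norm (- ((a t + lam) * u t)) \<le> M * (k t - 1)" if "t \<in> {x..z}" for t
      proof -
        have "\<bar>u t\<bar> \<le> M" using z(2)[of t] z(1) that by (auto simp: M_def)
        then show ?thesis by (simp add: k_def abs_mult mult.commute mult_right_mono)
      qed
      moreover have "(\<lambda>t. M * (k t - 1)) integrable_on {x..z}"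
        by (intro integrable_on_mult_right integrable_diff ks integrable_const_ivl)
      ultimately have "norm (integral {x..z} (\<lambda>t. - ((a t + lam) * u t))) \<le> integral {x..z} (\<lambda>t. M * (k t - 1))"
        using Iv by (intro integral_norm_bound_integral) (auto simp: has_integral_iff)
      then show ?thesis unfolding integral_unique[OF Iv] by (simp add: x0)
    qed
    moreover have "integral {x..z} (\<lambda>t. M) + integral {x..z} (\<lambda>t. M * (k t - 1)) = M * integral {x..z} k"
    proof -
      have "integral {x..z} (\<lambda>t. M) + integral {x..z} (\<lambda>t. M * (k t - 1))
          = integral {x..z} (\<lambda>t. M + M * (k t - 1))"
        by (intro integral_add[symmetric] integrable_on_mult_right integrable_diff ks integrable_const_ivl)
      also have "\<dots> = integral {x..z} (\<lambda>t. M * k t)" by (simp add: algebra_simps)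
      finally show ?thesis by simp
    qed
    moreover have "integral {x..z} k \<le> 1 / 2"
    proof -
      have "integral {0..x} k + integral {x..z} k = integral {0..z} k"
        using z xy by (intro Henstock_Kurzweil_Integration.integral_combine kint) auto
      moreover have "\<bar>integral {0..z} k - integral {0..x} k\<bar> < 1 / 2"
        using z xy by (intro \<delta>(2)) auto
      ultimately show ?thesis by linarith
    qed
    moreover have "M \<ge> 0" by (simp add: M_def)
    ultimately have "M \<le> M * (1 / 2)"
      unfolding M_def[symmetric] using mult_left_mono[of "integral {x..z} k" "1 / 2" M] by (simp add: M_def)
    then have "M = 0" using \<open>M \<ge> 0\<close> by simp
    show ?thesis
    proof
      fix w assume "w \<in> {x..y}"
      then have "\<bar>u w\<bar> + \<bar>v w\<bar> \<le> 0" using z(2)[of w] \<open>M = 0\<close> by (simp add: M_def)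
      then show "u w = 0 \<and> v w = 0" by auto
    qed
  qed
  obtain n :: nat where n: "n > 0" "1 / real n < \<delta>"
    using \<delta>(1) real_arch_inverse[of \<delta>] by (auto simp: inverse_eq_divide)
  have "j \<le> n \<Longrightarrow> \<forall>z\<in>{0..real j / real n}. u z = 0 \<and> v z = 0" for j
  proof (induction j)
    case 0 then show ?case using init by auto
  next
    case (Suc j)
    have "real (Suc j) / real n = real j / real n + 1 / real n" by (simp add: add_divide_distrib)
    moreover have "real (Suc j) / real n \<le> 1" using Suc.prems n by auto
    ultimately have "\<forall>z\<in>{real j / real n..real (Suc j) / real n}. u z = 0 \<and> v z = 0"
      using n Suc by (intro step) auto
    then show ?case using Suc by (metis Suc_leD atLeastAtMost_iff linorder_le_cases)
  qed
  from this[of n] show ?thesis using n t by simp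
qed

section \<open>Green's functions\<close>

lemma continuous_orthogonal_zero:
  fixes h :: "real \<Rightarrow> real"
  assumes c: "continuous_on I h"
    and orth: "\<And>\<sigma>. continuous_on I \<sigma> \<Longrightarrow> integral I (\<lambda>s. h s * \<sigma> s) = 0"
    and s: "s \<in> I"
  shows "h s = 0"
proof -
  have "integral I (\<lambda>s. h s * h s) = 0" by (rule orth[OF c])
  then have "\<forall>s\<in>I. h s * h s = 0"
    using integral_eq_0_iff[OF continuous_on_mult[OF c c]] by simp
  then show ?thesis using s by simp
qed

lemma continuous_in_L1: "continuous_on I \<sigma> \<Longrightarrow> \<sigma> \<in> L1"
  by (simp add: L1_def continuous_imp_integrable_real)

lemma LINT_continuous:
  fixes h :: "real \<Rightarrow> real"
  assumes "continuous_on I h"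
  shows "(LINT s|lebesgue_on I. h s) = integral I h"
  by (rule lebesgue_integral_eq_integral) (use assms in \<open>auto intro: continuous_imp_integrable_real\<close>)

lemma green_function_solution:
  assumes G: "is_green_function X a lam G" and X: "X \<subseteq> W21" and \<sigma>: "continuous_on I \<sigma>"
  obtains u where "u \<in> X" "solution a lam \<sigma> u (D u)" "\<And>t. t \<in> I \<Longrightarrow> u t = integral I (\<lambda>s. G t s * \<sigma> s)"
    "\<And>t. t \<in> I \<Longrightarrow> continuous_on I (G t)"
proof -
  have cG: "continuous_on I (G t)" if "t \<in> I" for t
  proof -
    have "continuous_on (I \<times> I) (\<lambda>(t, s). G t s)" using G by (simp add: is_green_function_def)
    then have "continuous_on I (\<lambda>s. case (t, s) of (t, s) \<Rightarrow> G t s)"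
      by (rule continuous_on_compose2) (use that in \<open>auto intro!: continuous_intros\<close>)
    then show ?thesis by simp
  qed
  obtain u where u: "u \<in> X" "\<forall>t\<in>I. u t = (LINT s|lebesgue_on I. G t s * \<sigma> s)"
    "AE t in lebesgue_on I. L a lam u t = \<sigma> t"
    using G continuous_in_L1[OF \<sigma>] unfolding is_green_function_def by blast
  have eq: "u t = integral I (\<lambda>s. G t s * \<sigma> s)" if "t \<in> I" for t
    using u(2) that by (simp add: LINT_continuous continuous_on_mult cG \<sigma>)
  show thesis
    by (rule that[OF u(1) solution_D[OF _ u(3)] eq cG]) (use u(1) X in auto)
qed

lemma Dirichlet_solution_zero:
  assumes nr: "nonresonant X_D a lam" and s: "solution a lam \<sigma> u v" and z: "\<And>t. \<sigma> t = 0"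
    and bc: "u 0 = 0" "u 1 = 0" and t: "t \<in> I"
  shows "u t = 0"
proof -
  have "u \<in> X_D" using solution_W21[OF s] bc by (simp add: X_D_def)
  moreover have "AE t in lebesgue_on I. L a lam u t = 0" using solution_AE[OF s] z by simp
  ultimately show ?thesis using nr t unfolding nonresonant_def by blast
qed

lemma Dirichlet_solution_unique:
  assumes nr: "nonresonant X_D a lam" and s: "solution a lam \<sigma> u v" "solution a lam \<sigma> u' v'"
    and bc: "u 0 = u' 0" "u 1 = u' 1" and t: "t \<in> I"
  shows "u t = u' t"
  using Dirichlet_solution_zero[OF nr solution_lincomb[OF s, of 1 "- 1"] _ _ _ t] bc by simp

text \<open>
  The classical Green's function built from solutions \<open>r\<^sub>1\<close> and \<open>r\<^sub>2\<close> that vanish at \<open>1\<close> and at \<open>0\<close>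
  respectively, with Wronskian \<open>w\<close>; \<open>max\<close> and \<open>min\<close> merge the cases \<open>s \<le> t\<close> and \<open>t \<le> s\<close>.
\<close>

definition Dirichlet_kernel :: "(real \<Rightarrow> real) \<Rightarrow> (real \<Rightarrow> real) \<Rightarrow> real \<Rightarrow> real \<Rightarrow> real \<Rightarrow> real" where
  "Dirichlet_kernel r\<^sub>1 r\<^sub>2 w t s = - (r\<^sub>1 (max t s) * r\<^sub>2 (min t s)) / w"

lemma continuous_Dirichlet_kernel:
  assumes "continuous_on I r\<^sub>1" "continuous_on I r\<^sub>2" "t \<in> I"
  shows "continuous_on I (Dirichlet_kernel r\<^sub>1 r\<^sub>2 w t)"
proof -
  have "continuous_on I (\<lambda>s. r\<^sub>1 (max t s))" "continuous_on I (\<lambda>s. r\<^sub>2 (min t s))"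
    using assms by (auto intro!: continuous_on_compose2[OF assms(1)] continuous_on_compose2[OF assms(2)] continuous_intros)
  then show ?thesis unfolding Dirichlet_kernel_def divide_inverse by (intro continuous_intros)
qed

text \<open>
  Variation of parameters: the function equals \<open>u = - (r\<^sub>1 A + r\<^sub>2 B) / w\<close> with
  \<open>A(t) = \<integral>\<^sub>0\<^sup>t r\<^sub>2 \<sigma>\<close> and \<open>B(t) = \<integral>\<^sub>t\<^sup>1 r\<^sub>1 \<sigma>\<close>. In \<open>u'\<close> the terms with \<open>A'\<close> and \<open>B'\<close> cancel, and in \<open>u''\<close>
  they combine to \<open>w \<sigma> / w\<close>. Continuity of \<open>\<sigma>\<close> makes \<open>A\<close> and \<open>B\<close> differentiable everywhere.
\<close>

lemma Dirichlet_kernel_solution: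
  assumes s1: "solution a lam (\<lambda>_. 0) r\<^sub>1 v\<^sub>1" and s2: "solution a lam (\<lambda>_. 0) r\<^sub>2 v\<^sub>2"
    and W: "\<And>t. t \<in> I \<Longrightarrow> r\<^sub>1 t * v\<^sub>2 t - v\<^sub>1 t * r\<^sub>2 t = w" and w: "w \<noteq> 0"
    and \<sigma>: "continuous_on I \<sigma>"
  shows "\<exists>v. solution a lam \<sigma> (\<lambda>t. integral I (\<lambda>s. Dirichlet_kernel r\<^sub>1 r\<^sub>2 w t s * \<sigma> s)) v"
proof -
  have c1: "continuous_on I r\<^sub>1" and c2: "continuous_on I r\<^sub>2"
    using solution_AC(1)[OF s1] solution_AC(1)[OF s2] AC_continuous_on by auto
  have i1: "continuous_on I (\<lambda>s. r\<^sub>1 s * \<sigma> s)" and i2: "continuous_on I (\<lambda>s. r\<^sub>2 s * \<sigma> s)"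
    by (intro continuous_intros c1 c2 \<sigma>)+
  define A where "A = (\<lambda>t. integral {0..t} (\<lambda>s. r\<^sub>2 s * \<sigma> s))"
  define B where "B = (\<lambda>t. integral I (\<lambda>s. r\<^sub>1 s * \<sigma> s) - integral {0..t} (\<lambda>s. r\<^sub>1 s * \<sigma> s))"
  define u where "u = (\<lambda>t. - (1 / w) * (r\<^sub>1 t * A t) + - (1 / w) * (r\<^sub>2 t * B t))"
  define v where "v = (\<lambda>t. - (1 / w) * (v\<^sub>1 t * A t) + - (1 / w) * (v\<^sub>2 t * B t))"
  have dA: "(A has_real_derivative r\<^sub>2 t * \<sigma> t) (at t within I)" if "t \<in> I" for t
    unfolding A_def by (rule integral_has_real_derivative[OF i2 that])
  have dB: "(B has_real_derivative - (r\<^sub>1 t * \<sigma> t)) (at t within I)" if "t \<in> I" for t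
    unfolding B_def by (rule derivative_eq_intros integral_has_real_derivative[OF i1 that] refl)+ simp
  have AC: "A \<in> AC" "B \<in> AC"
    by (rule AC_if_continuous_derivative[OF dA i2] AC_if_continuous_derivative[OF dB continuous_on_minus[OF i1]]; assumption)+
  have v: "v \<in> AC"
    unfolding v_def by (intro AC_lincomb AC_mult AC solution_AC(2)[OF s1] solution_AC(2)[OF s2])
  have du: "(u has_real_derivative v t) (at t within I)" if t: "t \<in> I" for t
  proof -
    have d: "(r\<^sub>1 has_real_derivative v\<^sub>1 t) (at t within I)" "(r\<^sub>2 has_real_derivative v\<^sub>2 t) (at t within I)"
      using s1 s2 t by (auto simp: solution_def)
    show ?thesis
      unfolding u_def v_def
      by (rule derivative_eq_intros d dA[OF t] dB[OF t] refl)+ (use w in \<open>simp add: field_simps\<close>)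
  qed
  obtain N1 N2 where N: "negligible N1" "negligible N2"
    "\<forall>t\<in>I - N1. (v\<^sub>1 has_real_derivative 0 - (a t + lam) * r\<^sub>1 t) (at t within I)"
    "\<forall>t\<in>I - N2. (v\<^sub>2 has_real_derivative 0 - (a t + lam) * r\<^sub>2 t) (at t within I)"
    using s1 s2 unfolding solution_def by blast
  have dv: "(v has_real_derivative \<sigma> t - (a t + lam) * u t) (at t within I)" if t: "t \<in> I - (N1 \<union> N2)" for t
  proof -
    have tI: "t \<in> I" using t by blast
    have d: "(v\<^sub>1 has_real_derivative - ((a t + lam) * r\<^sub>1 t)) (at t within I)"
      "(v\<^sub>2 has_real_derivative - ((a t + lam) * r\<^sub>2 t)) (at t within I)"
      using N(3,4) t by auto
    have "(v has_real_derivative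
        - (1 / w) * (v\<^sub>1 t * (r\<^sub>2 t * \<sigma> t) + - ((a t + lam) * r\<^sub>1 t) * A t)
        + - (1 / w) * (v\<^sub>2 t * (- (r\<^sub>1 t * \<sigma> t)) + - ((a t + lam) * r\<^sub>2 t) * B t)) (at t within I)"
      unfolding v_def by (rule derivative_eq_intros d dA[OF tI] dB[OF tI] refl)+ (simp add: algebra_simps)
    moreover have "- (1 / w) * (v\<^sub>1 t * (r\<^sub>2 t * \<sigma> t) + - ((a t + lam) * r\<^sub>1 t) * A t)
        + - (1 / w) * (v\<^sub>2 t * (- (r\<^sub>1 t * \<sigma> t)) + - ((a t + lam) * r\<^sub>2 t) * B t)
      = (1 / w) * (r\<^sub>1 t * v\<^sub>2 t - v\<^sub>1 t * r\<^sub>2 t) * \<sigma> t - (a t + lam) * u t"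
      unfolding u_def by (simp add: algebra_simps add_divide_distrib)
    ultimately show ?thesis using W[OF tI] w by simp
  qed
  have sol: "solution a lam \<sigma> u v"
    unfolding solution_def using du v dv negligible_Un[OF N(1,2)] by blast
  have eq: "integral I (\<lambda>s. Dirichlet_kernel r\<^sub>1 r\<^sub>2 w t s * \<sigma> s) = u t" if t: "t \<in> I" for t
  proof -
    have c: "continuous_on I (\<lambda>s. Dirichlet_kernel r\<^sub>1 r\<^sub>2 w t s * \<sigma> s)"
      by (intro continuous_intros continuous_Dirichlet_kernel c1 c2 \<sigma> t)
    have io: "f integrable_on {x..y}" if "continuous_on I f" "0 \<le> x" "y \<le> 1" for f :: "real \<Rightarrow> real" and x y
      by (rule integrable_continuous_real[OF continuous_on_subset[OF that(1)]]) (use that in auto)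
    have "integral {0..t} (\<lambda>s. Dirichlet_kernel r\<^sub>1 r\<^sub>2 w t s * \<sigma> s) = integral {0..t} (\<lambda>s. - (r\<^sub>1 t / w) * (r\<^sub>2 s * \<sigma> s))"
      by (rule Henstock_Kurzweil_Integration.integral_cong) (auto simp: Dirichlet_kernel_def max_def min_def)
    moreover have "integral {t..1} (\<lambda>s. Dirichlet_kernel r\<^sub>1 r\<^sub>2 w t s * \<sigma> s) = integral {t..1} (\<lambda>s. - (r\<^sub>2 t / w) * (r\<^sub>1 s * \<sigma> s))"
      by (rule Henstock_Kurzweil_Integration.integral_cong) (auto simp: Dirichlet_kernel_def max_def min_def)
    moreover have "integral {t..1} (\<lambda>s. r\<^sub>1 s * \<sigma> s) = B t"
      using Henstock_Kurzweil_Integration.integral_combine[of 0 t 1 "\<lambda>s. r\<^sub>1 s * \<sigma> s"] t io[OF i1]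
      by (simp add: B_def)
    moreover have "integral I (\<lambda>s. Dirichlet_kernel r\<^sub>1 r\<^sub>2 w t s * \<sigma> s) = integral {0..t} (\<lambda>s. Dirichlet_kernel r\<^sub>1 r\<^sub>2 w t s * \<sigma> s)
        + integral {t..1} (\<lambda>s. Dirichlet_kernel r\<^sub>1 r\<^sub>2 w t s * \<sigma> s)"
      by (rule Henstock_Kurzweil_Integration.integral_combine[symmetric]) (use t io[OF c] in simp_all)
    ultimately show ?thesis by (simp add: u_def A_def)
  qed
  have "solution a lam \<sigma> (\<lambda>t. integral I (\<lambda>s. Dirichlet_kernel r\<^sub>1 r\<^sub>2 w t s * \<sigma> s)) v"
    unfolding solution_def
  proof (intro conjI ballI)
    fix t assume t: "t \<in> I"
    show "((\<lambda>t. integral I (\<lambda>s. Dirichlet_kernel r\<^sub>1 r\<^sub>2 w t s * \<sigma> s)) has_real_derivative v t) (at t within I)"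
      by (rule has_field_derivative_transform_within[OF du[OF t] zero_less_one t]) (simp add: eq)
  next
    show "\<exists>N. negligible N \<and> (\<forall>t\<in>I - N. (v has_real_derivative \<sigma> t - (a t + lam) *
         integral I (\<lambda>s. Dirichlet_kernel r\<^sub>1 r\<^sub>2 w t s * \<sigma> s)) (at t within I))"
      using dv eq negligible_Un[OF N(1,2)] by (intro exI[of _ "N1 \<union> N2"]) auto
  qed (rule v)
  then show ?thesis by (rule exI[of _ v])
qed

text \<open>
  For each continuous \<open>\<sigma>\<close> both kernels produce the Dirichlet solution for \<open>\<sigma>\<close>, so their difference is
  orthogonal to \<open>\<sigma>\<close>. The Wronskian is evaluated at \<open>0\<close>, where it is \<open>v\<^sub>2 0\<close>, and at \<open>1\<close>, where it is
  \<open>- v\<^sub>1 1\<close>.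
\<close>

lemma Dirichlet_green_function_eq_kernel:
  assumes a: "a \<in> L1" and nr: "nonresonant X_D a lam" and G: "is_green_function X_D a lam G"
    and s1: "solution a lam (\<lambda>_. 0) r\<^sub>1 v\<^sub>1" and s2: "solution a lam (\<lambda>_. 0) r\<^sub>2 v\<^sub>2"
    and r1: "r\<^sub>1 0 = 1" "r\<^sub>1 1 = 0" and r2: "r\<^sub>2 0 = 0" "r\<^sub>2 1 = 1"
  shows "v\<^sub>2 0 \<noteq> 0" "v\<^sub>1 1 = - v\<^sub>2 0"
    and "t \<in> I \<Longrightarrow> s \<in> I \<Longrightarrow> G t s = Dirichlet_kernel r\<^sub>1 r\<^sub>2 (v\<^sub>2 0) t s"
proof -
  define w where "w = v\<^sub>2 0"
  have W: "r\<^sub>1 t * v\<^sub>2 t - v\<^sub>1 t * r\<^sub>2 t = w" if "t \<in> I" for t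
    using Wronskian_constant[OF s1 s2 that] r1 r2 by (simp add: w_def)
  show w0: "v\<^sub>2 0 \<noteq> 0"
    using solution_zero_initial_values[OF a s2 r2(1), of 1] r2(2) by auto
  show "v\<^sub>1 1 = - v\<^sub>2 0" using W[of 1] r1 r2 by (simp add: w_def)
  have c: "continuous_on I r\<^sub>1" "continuous_on I r\<^sub>2"
    using solution_AC(1)[OF s1] solution_AC(1)[OF s2] AC_continuous_on by auto
  assume t: "t \<in> I" and s: "s \<in> I"
  have cG: "continuous_on I (G t)"
    using green_function_solution[OF G _ continuous_on_const] t by (metis (no_types, lifting) X_D_def mem_Collect_eq subsetI)
  have cK: "continuous_on I (Dirichlet_kernel r\<^sub>1 r\<^sub>2 w t)" by (rule continuous_Dirichlet_kernel[OF c t])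
  have "G t s - Dirichlet_kernel r\<^sub>1 r\<^sub>2 w t s = 0"
  proof (rule continuous_orthogonal_zero[OF continuous_on_diff[OF cG cK] _ s])
    fix \<sigma> :: "real \<Rightarrow> real" assume \<sigma>: "continuous_on I \<sigma>"
    obtain u where u: "u \<in> X_D" "solution a lam \<sigma> u (D u)" "\<And>t. t \<in> I \<Longrightarrow> u t = integral I (\<lambda>s. G t s * \<sigma> s)"
      by (rule green_function_solution[OF G _ \<sigma>]) (auto simp: X_D_def)
    obtain v where v: "solution a lam \<sigma> (\<lambda>t. integral I (\<lambda>s. Dirichlet_kernel r\<^sub>1 r\<^sub>2 w t s * \<sigma> s)) v"
      using Dirichlet_kernel_solution[OF s1 s2 W _ \<sigma>] w0 by (auto simp: w_def)
    have "integral I (\<lambda>s. Dirichlet_kernel r\<^sub>1 r\<^sub>2 w 0 s * \<sigma> s) = integral I (\<lambda>s. 0)"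
      "integral I (\<lambda>s. Dirichlet_kernel r\<^sub>1 r\<^sub>2 w 1 s * \<sigma> s) = integral I (\<lambda>s. 0)"
      by (rule Henstock_Kurzweil_Integration.integral_cong, simp add: Dirichlet_kernel_def min_absorb1 max_absorb1 r1 r2)+
    then have "u t = integral I (\<lambda>s. Dirichlet_kernel r\<^sub>1 r\<^sub>2 w t s * \<sigma> s)"
      using u(1) by (intro Dirichlet_solution_unique[OF nr u(2) v _ _ t]) (auto simp: X_D_def)
    then have "integral I (\<lambda>s. G t s * \<sigma> s) - integral I (\<lambda>s. Dirichlet_kernel r\<^sub>1 r\<^sub>2 w t s * \<sigma> s) = 0"
      using u(3)[OF t] by simp
    then show "integral I (\<lambda>s. (G t s - Dirichlet_kernel r\<^sub>1 r\<^sub>2 w t s) * \<sigma> s) = 0"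
      unfolding left_diff_distrib
      by (subst Henstock_Kurzweil_Integration.integral_diff)
        (auto intro!: integrable_continuous_real continuous_on_mult cG cK \<sigma>)
  qed
  then show "G t s = Dirichlet_kernel r\<^sub>1 r\<^sub>2 (v\<^sub>2 0) t s" by (simp add: w_def)
qed

text \<open>
  Since \<open>u\<^sub>P(0) = u\<^sub>P(1)\<close>, the boundary values of \<open>u\<^sub>D\<close> are corrected to those of \<open>u\<^sub>P\<close> by a
  multiple of \<open>r\<^sub>1 + r\<^sub>2\<close>, which is \<open>1\<close> at both ends.
\<close>

lemma periodic_green_function_decomposition:
  assumes nr: "nonresonant X_D a lam"
    and GD: "is_green_function X_D a lam G\<^sub>D" and GP: "is_green_function X_P a lam G\<^sub>P"
    and s1: "solution a lam (\<lambda>_. 0) r\<^sub>1 v\<^sub>1" and s2: "solution a lam (\<lambda>_. 0) r\<^sub>2 v\<^sub>2"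
    and r1: "r\<^sub>1 0 = 1" "r\<^sub>1 1 = 0" and r2: "r\<^sub>2 0 = 0" "r\<^sub>2 1 = 1"
    and t: "t \<in> I" and s: "s \<in> I"
  shows "G\<^sub>P t s = G\<^sub>D t s + (r\<^sub>1 t + r\<^sub>2 t) * G\<^sub>P 1 s"
proof -
  have XD: "X_D \<subseteq> W21" and XP: "X_P \<subseteq> W21" by (auto simp: X_D_def X_P_def)
  have c: "continuous_on I (G\<^sub>D t)" if "t \<in> I" for t
    by (rule green_function_solution[OF GD XD continuous_on_const]) (use that in blast)
  have cP: "continuous_on I (G\<^sub>P t)" if "t \<in> I" for t
    by (rule green_function_solution[OF GP XP continuous_on_const]) (use that in blast)
  define h where "h = (\<lambda>s. G\<^sub>P t s - (G\<^sub>D t s + (r\<^sub>1 t + r\<^sub>2 t) * G\<^sub>P 1 s))"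
  have "h s = 0"
  proof (rule continuous_orthogonal_zero[OF _ _ s])
    show "continuous_on I h" unfolding h_def by (intro continuous_intros c cP t) auto
    fix \<sigma> :: "real \<Rightarrow> real" assume \<sigma>: "continuous_on I \<sigma>"
    obtain u\<^sub>D where uD: "u\<^sub>D \<in> X_D" "solution a lam \<sigma> u\<^sub>D (D u\<^sub>D)"
      "\<And>t. t \<in> I \<Longrightarrow> u\<^sub>D t = integral I (\<lambda>s. G\<^sub>D t s * \<sigma> s)"
      by (rule green_function_solution[OF GD XD \<sigma>]) blast
    obtain u\<^sub>P where uP: "u\<^sub>P \<in> X_P" "solution a lam \<sigma> u\<^sub>P (D u\<^sub>P)"
      "\<And>t. t \<in> I \<Longrightarrow> u\<^sub>P t = integral I (\<lambda>s. G\<^sub>P t s * \<sigma> s)"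
      by (rule green_function_solution[OF GP XP \<sigma>]) blast
    note rr = solution_lincomb[OF s1 s2, of 1 1]
    have sol: "solution a lam \<sigma> (\<lambda>t. u\<^sub>D t + u\<^sub>P 1 * (r\<^sub>1 t + r\<^sub>2 t)) (\<lambda>t. D u\<^sub>D t + u\<^sub>P 1 * (v\<^sub>1 t + v\<^sub>2 t))"
      using solution_lincomb[OF uD(2) rr, of 1 "u\<^sub>P 1"] by simp
    have "u\<^sub>P t = u\<^sub>D t + u\<^sub>P 1 * (r\<^sub>1 t + r\<^sub>2 t)"
      using uD(1) uP(1) r1 r2
      by (intro Dirichlet_solution_unique[OF nr uP(2) sol _ _ t]) (auto simp: X_D_def X_P_def)
    then have "integral I (\<lambda>s. G\<^sub>P t s * \<sigma> s) - (integral I (\<lambda>s. G\<^sub>D t s * \<sigma> s)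
        + (r\<^sub>1 t + r\<^sub>2 t) * integral I (\<lambda>s. G\<^sub>P 1 s * \<sigma> s)) = 0"
      using uD(3)[OF t] uP(3)[OF t] uP(3)[of 1] by simp
    moreover have "integral I (\<lambda>s. h s * \<sigma> s) = integral I (\<lambda>s. G\<^sub>P t s * \<sigma> s) - (integral I (\<lambda>s. G\<^sub>D t s * \<sigma> s)
        + (r\<^sub>1 t + r\<^sub>2 t) * integral I (\<lambda>s. G\<^sub>P 1 s * \<sigma> s))"
    proof -
      have i: "(\<lambda>s. G\<^sub>P t s * \<sigma> s) integrable_on I" "(\<lambda>s. G\<^sub>D t s * \<sigma> s) integrable_on I"
        "(\<lambda>s. G\<^sub>P 1 s * \<sigma> s) integrable_on I"
        by (intro integrable_continuous_real continuous_on_mult c cP \<sigma> t; simp)+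
      have "((\<lambda>s. G\<^sub>P t s * \<sigma> s - (G\<^sub>D t s * \<sigma> s + (r\<^sub>1 t + r\<^sub>2 t) * (G\<^sub>P 1 s * \<sigma> s))) has_integral
         integral I (\<lambda>s. G\<^sub>P t s * \<sigma> s) - (integral I (\<lambda>s. G\<^sub>D t s * \<sigma> s)
        + (r\<^sub>1 t + r\<^sub>2 t) * integral I (\<lambda>s. G\<^sub>P 1 s * \<sigma> s))) I"
        by (intro has_integral_diff has_integral_add has_integral_mult_right integrable_integral i)
      then show ?thesis by (intro integral_unique) (simp add: h_def algebra_simps)
    qed
    ultimately show "integral I (\<lambda>s. h s * \<sigma> s) = 0" by simp
  qed
  then show ?thesis by (simp add: h_def)
qed

theorem theorem3p1:
  fixes a :: "real \<Rightarrow> real" and lam :: real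
    and G\<^sub>D G\<^sub>P :: "real \<Rightarrow> real \<Rightarrow> real" and r\<^sub>1 r\<^sub>2 :: "real \<Rightarrow> real"
  assumes "a \<in> L1"
    and "nonresonant X_D a lam" and "nonresonant X_P a lam"
    and "is_green_function X_D a lam G\<^sub>D" and "is_green_function X_P a lam G\<^sub>P"
    and "is_r1 a lam r\<^sub>1" and "is_r2 a lam r\<^sub>2"
  shows "(\<forall>t\<in>I. \<forall>s\<in>I. G\<^sub>P t s = G\<^sub>D t s + (r\<^sub>1 t + r\<^sub>2 t) * G\<^sub>P 1 s) \<and>
    (\<exists>d\<^sub>0 d\<^sub>1. has_boundary_ds G\<^sub>D 0 d\<^sub>0 \<and> has_boundary_ds G\<^sub>D 1 d\<^sub>1 \<and>
      (\<forall>t\<in>I. \<forall>s\<in>I. G\<^sub>P t s = G\<^sub>D t s + (d\<^sub>1 t - d\<^sub>0 t) * G\<^sub>P 1 s))"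
proof -
  have s1: "solution a lam (\<lambda>_. 0) r\<^sub>1 (D r\<^sub>1)" and r1: "r\<^sub>1 0 = 1" "r\<^sub>1 1 = 0"
    using assms(6) by (auto simp: is_r1_def intro: solution_D)
  have s2: "solution a lam (\<lambda>_. 0) r\<^sub>2 (D r\<^sub>2)" and r2: "r\<^sub>2 0 = 0" "r\<^sub>2 1 = 1"
    using assms(7) by (auto simp: is_r2_def intro: solution_D)
  have decomp: "G\<^sub>P t s = G\<^sub>D t s + (r\<^sub>1 t + r\<^sub>2 t) * G\<^sub>P 1 s" if "t \<in> I" "s \<in> I" for t s
    using periodic_green_function_decomposition[OF assms(2,4,5) s1 s2 r1 r2 that] .
  define w where "w = D r\<^sub>2 0"
  note K = Dirichlet_green_function_eq_kernel[OF assms(1,2,4) s1 s2 r1 r2, folded w_def]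
  have lim: "(f \<longlongrightarrow> f 0) (at_right 0)" "(f \<longlongrightarrow> f 1) (at_left 1)" if "continuous_on I f" for f :: "real \<Rightarrow> real"
  proof -
    have "(f \<longlongrightarrow> f 0) (at 0 within I)" "(f \<longlongrightarrow> f 1) (at 1 within I)"
      using that by (auto simp: continuous_on)
    then show "(f \<longlongrightarrow> f 0) (at_right 0)" "(f \<longlongrightarrow> f 1) (at_left 1)"
      by (simp_all add: at_within_Icc_at_right at_within_Icc_at_left)
  qed
  have c: "continuous_on I r\<^sub>1" "continuous_on I r\<^sub>2"
    using solution_AC(1)[OF s1] solution_AC(1)[OF s2] AC_continuous_on by auto
  have "(G\<^sub>D t has_real_derivative - r\<^sub>1 t) (at 0 within I)" if t: "t \<in> {0<..<1}" for t
  proof -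
    have "(r\<^sub>2 has_real_derivative w) (at 0 within I)" using s2 by (auto simp: solution_def w_def)
    then have "((\<lambda>s. - (r\<^sub>1 t * r\<^sub>2 s) / w) has_real_derivative - r\<^sub>1 t) (at 0 within I)"
      by (auto intro!: derivative_eq_intros simp: K(1))
    \<comment> \<open>The formula for \<open>s \<le> t\<close> is valid within distance \<open>t\<close> of \<open>0\<close>, a neighbourhood since \<open>t > 0\<close>.\<close>
    then show ?thesis
      by (rule has_field_derivative_transform_within[of _ _ _ _ t])
        (use t K(3) in \<open>auto simp: Dirichlet_kernel_def dist_real_def max_def min_def\<close>)
  qed
  then have d0: "has_boundary_ds G\<^sub>D 0 (\<lambda>t. - r\<^sub>1 t)"
    unfolding has_boundary_ds_def using lim[OF continuous_on_minus[OF c(1)]] by auto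
  have "(G\<^sub>D t has_real_derivative r\<^sub>2 t) (at 1 within I)" if t: "t \<in> {0<..<1}" for t
  proof -
    have "(r\<^sub>1 has_real_derivative - w) (at 1 within I)" using s1 unfolding solution_def K(2)[symmetric] by auto
    then have "((\<lambda>s. - (r\<^sub>1 s * r\<^sub>2 t) / w) has_real_derivative r\<^sub>2 t) (at 1 within I)"
      by (auto intro!: derivative_eq_intros simp: K(1))
    then show ?thesis
      by (rule has_field_derivative_transform_within[of _ _ _ _ "1 - t"])
        (use t K(3) in \<open>auto simp: Dirichlet_kernel_def dist_real_def max_def min_def\<close>)
  qed
  then have d1: "has_boundary_ds G\<^sub>D 1 r\<^sub>2"
    unfolding has_boundary_ds_def using lim[OF c(2)] by auto
  have first: "\<forall>t\<in>I. \<forall>s\<in>I. G\<^sub>P t s = G\<^sub>D t s + (r\<^sub>1 t + r\<^sub>2 t) * G\<^sub>P 1 s"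
    using decomp by blast
  have "r\<^sub>2 t - - r\<^sub>1 t = r\<^sub>1 t + r\<^sub>2 t" for t by simp
  then have second: "\<forall>t\<in>I. \<forall>s\<in>I. G\<^sub>P t s = G\<^sub>D t s + (r\<^sub>2 t - - r\<^sub>1 t) * G\<^sub>P 1 s"
    using first by presburger
  show ?thesis
    by (rule conjI[OF first], rule exI[of _ "\<lambda>t. - r\<^sub>1 t"], rule exI[of _ r\<^sub>2]) (intro conjI d0 d1 second)
qed

end
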